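(* Let $(u,p)$, with $u:\mathbb R^3\to\mathbb R^3$ and $p:\mathbb R^3\to\mathbb R$, be a smooth solution of the stationary Navier--Stokes equations $$-\Delta u+(u\cdot\nabla)u+\nabla p=0,\qquad \nabla\cdot u=0\qquad\text{in }\mathbb R^3,$$ satisfying $u(x)\to0$ as $|x|\to+\infty$ and $\int_{\mathbb R^3}|\nabla u|^2\,dx<+\infty$, with the pressure normalized by an additive constant so that $Q:=\frac12|u|^2+p$ satisfies $Q(x)\to0$ as $|x|\to+\infty$. Let $\xi:[0,+\infty)\to[0,+\infty)$ be a continuous nondecreasing function with $\xi(0)=0$, $\xi(s)>0$ for $s>0$, and $\int_0^1\frac{ds}{\xi(s)}=+\infty$. Let $2\le q,r\le+\infty$ satisfy $\frac1q+\frac1r=\frac12$ (with $\frac1{+\infty}=0$), and let $a,b\in\mathbb R$ satisfy $a+b=\frac12$. Suppose that $$\frac{|u_T|\,|\Theta|}{\xi(|Q|)^a}\in L^q(\mathbb R^3),\qquad \frac{|\omega_T|}{\xi(|Q|)^b}\in L^r(\mathbb R^3).$$ Then $u\equiv0$.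
   Context: Notation. For the smooth solution $(u,p)$, $\omega:=\nabla\times u$ is the vorticity and $Q:=\frac12|u|^2+p$ is the head pressure. Under the decay condition $u\to0$ at infinity and $\int_{\mathbb R^3}|\nabla u|^2\,dx<+\infty$, it is known that $Q$ has a finite limit at infinity; the pressure is normalized by subtracting a constant so that this limit is $0$. With this normalization, either $u\equiv0$ (and $Q\equiv 0$) or $Q<0$ everywhere in $\mathbb R^3$; in the latter case $\xi(|Q|)>0$ everywhere, so the quotients in the claim are well defined. On $\{|\nabla Q|>0\}$ set $$n_Q:=\frac{\nabla Q}{|\nabla Q|},\qquad u_T:=u-(u\cdot n_Q)n_Q,\qquad \omega_T:=\omega-(\omega\cdot n_Q)n_Q,$$ and on $\{|\nabla Q|=0\}$ set $n_Q=u_T=\omega_T=0$. The tangential angular factor is $$\Theta:=\frac{(u_T\times\omega_T)\cdot n_Q}{|u_T|\,|\omega_T|}\ \text{ on }\{|u_T|\,|\omega_T|\,|\nabla Q|>0\},\qquad \Theta:=0\ \text{ on }\{|u_T|\,|\omega_T|\,|\nabla Q|=0\}.$$ *)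

theory Defs
  imports "HOL-Analysis.Analysis" "HOL-Probability.Essential_Supremum"
begin

text \<open>Since the domain is finite-dimensional, continuity of all iterated directional derivatives
  is the usual \<open>C\<^sup>k\<close> condition.\<close>

primrec Ck :: "nat \<Rightarrow> ('a::euclidean_space \<Rightarrow> 'b::real_normed_vector) \<Rightarrow> bool" where
  "Ck 0 f \<longleftrightarrow> continuous_on UNIV f"
| "Ck (Suc k) f \<longleftrightarrow>
     (\<forall>x. f differentiable at x) \<and> (\<forall>v. Ck k (\<lambda>x. frechet_derivative f (at x) v))"

definition smooth :: "('a::euclidean_space \<Rightarrow> 'b::real_normed_vector) \<Rightarrow> bool" where
  "smooth f \<longleftrightarrow> (\<forall>k. Ck k f)"

definition pd :: "3 \<Rightarrow> (real^3 \<Rightarrow> 'b::real_normed_vector) \<Rightarrow> real^3 \<Rightarrow> 'b" where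
  "pd i f x = frechet_derivative f (at x) (axis i 1)"

definition grad :: "(real^3 \<Rightarrow> real) \<Rightarrow> real^3 \<Rightarrow> real^3" where
  "grad f x = (\<chi> i. pd i f x)"

definition divergence :: "(real^3 \<Rightarrow> real^3) \<Rightarrow> real^3 \<Rightarrow> real" where
  "divergence u x = (\<Sum>i\<in>UNIV. pd i u x $ i)"

definition laplacian :: "(real^3 \<Rightarrow> 'b::real_normed_vector) \<Rightarrow> real^3 \<Rightarrow> 'b" where
  "laplacian f x = (\<Sum>i\<in>UNIV. pd i (pd i f) x)"

definition curl :: "(real^3 \<Rightarrow> real^3) \<Rightarrow> real^3 \<Rightarrow> real^3" where
  "curl u x = vector [pd 2 u x $ 3 - pd 3 u x $ 2,
                      pd 3 u x $ 1 - pd 1 u x $ 3,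
                      pd 1 u x $ 2 - pd 2 u x $ 1]"

definition convective :: "(real^3 \<Rightarrow> real^3) \<Rightarrow> (real^3 \<Rightarrow> real^3) \<Rightarrow> real^3 \<Rightarrow> real^3" where
  "convective v u x = (\<Sum>i\<in>UNIV. v x $ i *\<^sub>R pd i u x)"

text \<open>\<open>|\<nabla>u|\<close> is the Frobenius norm of the velocity gradient.\<close>

definition grad_norm_sq :: "(real^3 \<Rightarrow> real^3) \<Rightarrow> real^3 \<Rightarrow> real" where
  "grad_norm_sq u x = (\<Sum>i\<in>UNIV. \<Sum>j\<in>UNIV. (pd i u x $ j)\<^sup>2)"

definition stationary_Navier_Stokes :: "(real^3 \<Rightarrow> real^3) \<Rightarrow> (real^3 \<Rightarrow> real) \<Rightarrow> bool" where
  "stationary_Navier_Stokes u p \<longleftrightarrow>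
     (\<forall>x. - laplacian u x + convective u u x + grad p x = 0 \<and> divergence u x = 0)"

definition head_pressure :: "(real^3 \<Rightarrow> real^3) \<Rightarrow> (real^3 \<Rightarrow> real) \<Rightarrow> real^3 \<Rightarrow> real" where
  "head_pressure u p x = 1/2 * (norm (u x))\<^sup>2 + p x"

definition normal_Q :: "(real^3 \<Rightarrow> real^3) \<Rightarrow> (real^3 \<Rightarrow> real) \<Rightarrow> real^3 \<Rightarrow> real^3" where
  "normal_Q u p x =
     (if norm (grad (head_pressure u p) x) > 0
      then grad (head_pressure u p) x /\<^sub>R norm (grad (head_pressure u p) x)
      else 0)"

text \<open>The tangential part of a vector field \<open>v\<close> with respect to the level sets of \<open>Q\<close>; by
  convention it is 0 (and not \<open>v\<close>) at the critical points of \<open>Q\<close>.\<close>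

definition tangential ::
  "(real^3 \<Rightarrow> real^3) \<Rightarrow> (real^3 \<Rightarrow> real) \<Rightarrow> (real^3 \<Rightarrow> real^3) \<Rightarrow> real^3 \<Rightarrow> real^3" where
  "tangential u p v x =
     (if norm (grad (head_pressure u p) x) > 0
      then v x - (v x \<bullet> normal_Q u p x) *\<^sub>R normal_Q u p x
      else 0)"

definition u_tan :: "(real^3 \<Rightarrow> real^3) \<Rightarrow> (real^3 \<Rightarrow> real) \<Rightarrow> real^3 \<Rightarrow> real^3" where
  "u_tan u p = tangential u p u"

definition omega_tan :: "(real^3 \<Rightarrow> real^3) \<Rightarrow> (real^3 \<Rightarrow> real) \<Rightarrow> real^3 \<Rightarrow> real^3" where
  "omega_tan u p = tangential u p (curl u)"

definition Theta :: "(real^3 \<Rightarrow> real^3) \<Rightarrow> (real^3 \<Rightarrow> real) \<Rightarrow> real^3 \<Rightarrow> real" where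
  "Theta u p x =
     (if norm (u_tan u p x) * norm (omega_tan u p x) * norm (grad (head_pressure u p) x) > 0
      then (cross3 (u_tan u p x) (omega_tan u p x) \<bullet> normal_Q u p x)
             / (norm (u_tan u p x) * norm (omega_tan u p x))
      else 0)"

definition in_Lp :: "'a measure \<Rightarrow> ennreal \<Rightarrow> ('a \<Rightarrow> real) \<Rightarrow> bool" where
  "in_Lp M q f \<longleftrightarrow>
     f \<in> borel_measurable M \<and>
     (if q = \<infinity> then esssup M (\<lambda>x. ereal \<bar>f x\<bar>) < \<infinity>
      else integrable M (\<lambda>x. \<bar>f x\<bar> powr enn2real q))"

end

theory Submission
  imports Defs
begin

text \<open>Write \<open>f = -Q\<close>. The equations give \<open>\<Delta>Q - u \<cdot> \<nabla>Q = |\<omega>|\<^sup>2\<close> and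
  \<open>\<nabla>Q = u \<times> \<omega> + \<Delta>u\<close>. For \<open>h \<ge> 0\<close> supported away from \<open>0\<close> and \<open>\<psi>' = h\<close>, testing the first
  identity with \<open>\<psi>(f)\<close> gives \<open>\<integral> \<psi>(f) |\<omega>|\<^sup>2 = \<integral> h(f) |\<nabla>Q|\<^sup>2\<close>, since the transport term is a divergence.
  As \<open>\<Delta>u\<close> is divergence free, the right-hand side is \<open>\<integral> h(f) \<nabla>Q \<cdot> (u \<times> \<omega>)\<close>, hence by Young's inequality
  at most \<open>\<integral> h(f) (|u\<^sub>T| |\<omega>\<^sub>T| \<Theta>)\<^sup>2\<close>. For \<open>h \<le> 1/\<xi>\<close> this is bounded by a constant, the squared norm
  of the product of the two given functions, which lies in \<open>L\<^sup>2\<close>.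
  Letting \<open>h\<close> increase to \<open>1/\<xi>\<close>, Osgood's condition makes \<open>\<psi>\<close> blow up, so \<open>\<omega> = 0\<close> where \<open>Q < 0\<close>.
  The maximum principle then gives \<open>Q = 0\<close>, hence \<open>\<omega> = 0\<close> and \<open>\<Delta>u = 0\<close>, hence \<open>u = 0\<close>.

  Using truncations of \<open>1/\<xi>\<close> as test functions replaces integration over the level sets of \<open>Q\<close> (and
  with it Sard's theorem and the coarea formula).\<close>

section \<open>Smooth functions and partial derivatives\<close>

named_theorems smooth_intros

lemma Ck_SucD: "Ck (Suc k) f \<Longrightarrow> Ck k f"
proof (induction k arbitrary: f)
  case 0
  then have "\<And>x. f differentiable at x" by simp
  then show ?case
    by (simp add: differentiable_imp_continuous_within continuous_on_eq_continuous_at)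
qed (simp only: Ck.simps, blast)

lemma smooth_imp_differentiable: "smooth f \<Longrightarrow> f differentiable at x"
  unfolding smooth_def using Ck.simps(2) by blast

lemma smooth_imp_continuous_on: "smooth f \<Longrightarrow> continuous_on S f"
  unfolding smooth_def using Ck.simps(1) continuous_on_subset subset_UNIV by blast

lemma smooth_frechet_derivative:
  "smooth f \<Longrightarrow> smooth (\<lambda>x. frechet_derivative f (at x) v)"
  unfolding smooth_def using Ck.simps(2) by blast

lemma smooth_has_derivative: "smooth f \<Longrightarrow> (f has_derivative frechet_derivative f (at x)) (at x)"
  using frechet_derivative_works smooth_imp_differentiable by blast

lemma Ck_const: "Ck k (\<lambda>x. c)"
  by (induction k arbitrary: c) auto

lemma smooth_const [smooth_intros]: "smooth (\<lambda>x. c)"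
  by (simp add: smooth_def Ck_const)

lemma frechet_derivative_add:
  assumes "f differentiable at x" "g differentiable at x"
  shows "frechet_derivative (\<lambda>x. f x + g x) (at x) = 
    (\<lambda>v. frechet_derivative f (at x) v + frechet_derivative g (at x) v)"
  by (rule frechet_derivative_at[symmetric, OF has_derivative_add])
    (use assms frechet_derivative_works in blast)+

lemma frechet_derivative_mult:
  fixes f g :: "'a::real_normed_vector \<Rightarrow> real"
  assumes "f differentiable at x" "g differentiable at x"
  shows "frechet_derivative (\<lambda>x. f x * g x) (at x) = 
    (\<lambda>v. f x * frechet_derivative g (at x) v + frechet_derivative f (at x) v * g x)"
  by (rule frechet_derivative_at[symmetric, OF has_derivative_mult])
    (use assms frechet_derivative_works in blast)+

lemma frechet_derivative_bounded_linear:
  assumes "bounded_linear h" "f differentiable at x"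
  shows "frechet_derivative (\<lambda>x. h (f x)) (at x) = (\<lambda>v. h (frechet_derivative f (at x) v))"
  by (rule frechet_derivative_at[symmetric, OF bounded_linear.has_derivative])
    (use assms frechet_derivative_works in blast)+

lemma Ck_add: "Ck k f \<Longrightarrow> Ck k g \<Longrightarrow> Ck k (\<lambda>x. f x + g x)"
proof (induction k arbitrary: f g)
  case 0
  then show ?case by (simp add: continuous_intros)
qed (auto simp: frechet_derivative_add)

lemma Ck_mult:
  fixes f g :: "'a::euclidean_space \<Rightarrow> real"
  shows "Ck k f \<Longrightarrow> Ck k g \<Longrightarrow> Ck k (\<lambda>x. f x * g x)"
proof (induction k arbitrary: f g)
  case 0
  then show ?case by (simp add: continuous_intros)
next
  case (Suc k)
  \<comment> \<open>The product rule leaves one factor undifferentiated in each summand, so the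
    induction hypothesis is also applied to \<open>f\<close> and \<open>g\<close> themselves at the
    lower order.\<close>
  from Suc.prems have "Ck k f" "Ck k g" using Ck_SucD by blast+
  with Suc show ?case by (auto simp: frechet_derivative_mult intro!: Ck_add)
qed

lemma Ck_bounded_linear:
  assumes "bounded_linear h"
  shows "Ck k f \<Longrightarrow> Ck k (\<lambda>x. h (f x))"
proof (induction k arbitrary: f)
  case 0
  then show ?case by (simp add: bounded_linear.continuous_on[OF assms])
next
  case (Suc k)
  then have "(\<lambda>x. h (f x)) differentiable at x" for x
    using bounded_linear.has_derivative[OF assms] by (fastforce simp: differentiable_def)
  with Suc show ?case by (simp add: frechet_derivative_bounded_linear[OF assms])
qed

lemma smooth_add [smooth_intros]: "smooth f \<Longrightarrow> smooth g \<Longrightarrow> smooth (\<lambda>x. f x + g x)"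
  by (simp add: smooth_def Ck_add)

lemma smooth_mult [smooth_intros]:
  fixes f g :: "'a::euclidean_space \<Rightarrow> real"
  shows "smooth f \<Longrightarrow> smooth g \<Longrightarrow> smooth (\<lambda>x. f x * g x)"
  by (simp add: smooth_def Ck_mult)

lemma smooth_bounded_linear:
  "bounded_linear h \<Longrightarrow> smooth f \<Longrightarrow> smooth (\<lambda>x. h (f x))"
  by (simp add: smooth_def Ck_bounded_linear)

lemma smooth_minus [smooth_intros]: "smooth f \<Longrightarrow> smooth (\<lambda>x. - f x)"
  by (rule smooth_bounded_linear[OF bounded_linear_minus[OF bounded_linear_ident]])

lemma smooth_sum [smooth_intros]: "(\<And>i. i \<in> I \<Longrightarrow> smooth (f i)) \<Longrightarrow> smooth (\<lambda>x. \<Sum>i\<in>I. f i x)"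
  by (induction I rule: infinite_finite_induct) (simp_all add: smooth_intros)

lemma smooth_component [smooth_intros]: "smooth u \<Longrightarrow> smooth (\<lambda>x. u x $ j)"
  by (rule smooth_bounded_linear[OF bounded_linear_vec_nth])

lemma smooth_pd [smooth_intros]: "smooth f \<Longrightarrow> smooth (pd i f)"
  using smooth_frechet_derivative[of f "axis i 1"] by (simp add: pd_def[abs_def])

lemma pd_const [simp]: "pd i (\<lambda>x. c) = (\<lambda>x. 0)"
  by (simp add: fun_eq_iff pd_def)

lemma pd_add: "smooth f \<Longrightarrow> smooth g \<Longrightarrow> pd i (\<lambda>x. f x + g x) = (\<lambda>x. pd i f x + pd i g x)"
  by (simp add: pd_def fun_eq_iff frechet_derivative_add smooth_imp_differentiable)

lemma pd_mult:
  fixes f g :: "real^3 \<Rightarrow> real"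
  shows "smooth f \<Longrightarrow> smooth g \<Longrightarrow> pd i (\<lambda>x. f x * g x) = (\<lambda>x. f x * pd i g x + pd i f x * g x)"
  by (simp add: pd_def fun_eq_iff frechet_derivative_mult smooth_imp_differentiable)

lemma pd_minus: "smooth f \<Longrightarrow> pd i (\<lambda>x. - f x) = (\<lambda>x. - pd i f x)"
  by (simp add: pd_def fun_eq_iff smooth_imp_differentiable bounded_linear_minus[OF bounded_linear_ident]
    frechet_derivative_bounded_linear[of uminus])

lemma pd_sum:
  "(\<And>j. j \<in> I \<Longrightarrow> smooth (f j)) \<Longrightarrow> pd i (\<lambda>x. \<Sum>j\<in>I. f j x) = (\<lambda>x. \<Sum>j\<in>I. pd i (f j) x)"
  by (induction I rule: infinite_finite_induct) (simp_all add: pd_add smooth_sum)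

lemma pd_component: "smooth u \<Longrightarrow> pd i (\<lambda>x. u x $ j) = (\<lambda>x. pd i u x $ j)"
  by (simp add: pd_def fun_eq_iff smooth_imp_differentiable
    frechet_derivative_bounded_linear[OF bounded_linear_vec_nth])

section \<open>Symmetry of second derivatives\<close>

lemma smooth_second_difference:
  fixes f :: "'a::euclidean_space \<Rightarrow> real"
  assumes f: "smooth f" and t: "t > 0"
  shows "\<exists>s\<in>{0<..<t}. \<exists>r\<in>{0<..<t}.
    f (x + t *\<^sub>R v + t *\<^sub>R w) - f (x + t *\<^sub>R v) - (f (x + t *\<^sub>R w) - f x) =
    t^2 * frechet_derivative (\<lambda>x. frechet_derivative f (at x) v) (at (x + s *\<^sub>R v + r *\<^sub>R w)) w"
proof -
  have d: "((\<lambda>s. g (c + s *\<^sub>R a)) has_real_derivative frechet_derivative g (at (c + s *\<^sub>R a)) a) (at s)"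
    if "smooth g" for g :: "'a \<Rightarrow> real" and c a s
  proof -
    have "((\<lambda>s. g (c + s *\<^sub>R a)) has_derivative
        (\<lambda>h. frechet_derivative g (at (c + s *\<^sub>R a)) (h *\<^sub>R a))) (at s)"
      by (rule has_derivative_compose[OF _ smooth_has_derivative[OF that]])
        (auto intro!: derivative_eq_intros)
    moreover have "(\<lambda>h. frechet_derivative g (at (c + s *\<^sub>R a)) (h *\<^sub>R a)) =
        (\<lambda>h. frechet_derivative g (at (c + s *\<^sub>R a)) a * h)"
      using linear_frechet_derivative[OF smooth_imp_differentiable[OF that]]
      by (auto simp: linear_cmul)
    ultimately show ?thesis by (simp add: has_field_derivative_def)
  qed
  \<comment> \<open>The mixed second difference is the increment of \<open>G\<close> from 0 to
    \<open>t\<close>. The mean value theorem is used along \<open>v\<close>, then for the resulting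
    directional derivative along \<open>w\<close>; each use contributes a factor
    \<open>t\<close>.\<close>
  define G where "G s = f ((x + t *\<^sub>R w) + s *\<^sub>R v) - f (x + s *\<^sub>R v)" for s
  have "(G has_real_derivative (frechet_derivative f (at ((x + t *\<^sub>R w) + s *\<^sub>R v)) v
      - frechet_derivative f (at (x + s *\<^sub>R v)) v)) (at s)" for s
    unfolding G_def by (intro DERIV_diff d f)
  from MVT2[OF t this] obtain s where s: "0 < s" "s < t" and
    1: "G t - G 0 = t * (frechet_derivative f (at ((x + t *\<^sub>R w) + s *\<^sub>R v)) v
      - frechet_derivative f (at (x + s *\<^sub>R v)) v)" by auto
  from MVT2[OF t d[OF smooth_frechet_derivative[OF f, of v], where c = "x + s *\<^sub>R v" and a = w]]
  obtain r where r: "0 < r" "r < t" and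
    2: "frechet_derivative f (at ((x + s *\<^sub>R v) + t *\<^sub>R w)) v - frechet_derivative f (at (x + s *\<^sub>R v)) v
     = t * frechet_derivative (\<lambda>x. frechet_derivative f (at x) v) (at (x + s *\<^sub>R v + r *\<^sub>R w)) w"
    by auto
  from 1 2 have "G t - G 0 = t * (t * 
      frechet_derivative (\<lambda>x. frechet_derivative f (at x) v) (at (x + s *\<^sub>R v + r *\<^sub>R w)) w)"
    by (simp add: add_ac)
  with s r show ?thesis
    by (intro bexI[of _ s] bexI[of _ r]) (auto simp: G_def power2_eq_square add_ac)
qed

text \<open>The mixed second difference is symmetric in \<open>v\<close> and \<open>w\<close>, so
  the two mixed derivatives agree at a pair of points arbitrarily close to \<open>x\<close>;
  continuity carries the equality to \<open>x\<close>.\<close>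

lemma frechet_derivative_commute:
  fixes f :: "'a::euclidean_space \<Rightarrow> real"
  assumes f: "smooth f"
  shows "frechet_derivative (\<lambda>x. frechet_derivative f (at x) v) (at x) w =
    frechet_derivative (\<lambda>x. frechet_derivative f (at x) w) (at x) v"
proof -
  define D where "D v w x = frechet_derivative (\<lambda>x. frechet_derivative f (at x) v) (at x) w" for v w x
  have cont: "isCont (D v w) x" for v w
    using smooth_imp_continuous_on[OF smooth_frechet_derivative[OF smooth_frechet_derivative[OF f]], of UNIV v w]
    by (simp add: D_def[abs_def] continuous_on_eq_continuous_at)
  have "dist (D v w x) (D w v x) \<le> 0 + e" if "e > 0" for e
  proof -
    obtain d1 where d1: "d1 > 0" "\<And>y. dist y x < d1 \<Longrightarrow> dist (D v w y) (D v w x) < e/2"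
      using cont[of v w] \<open>e > 0\<close> unfolding continuous_at_eps_delta by (meson half_gt_zero)
    obtain d2 where d2: "d2 > 0" "\<And>y. dist y x < d2 \<Longrightarrow> dist (D w v y) (D w v x) < e/2"
      using cont[of w v] \<open>e > 0\<close> unfolding continuous_at_eps_delta by (meson half_gt_zero)
    \<comment> \<open>Since \<open>t * N = min d1 d2\<close>, every intermediate point stays within
      both continuity radii. The summand 1 keeps \<open>N\<close> positive and the estimate
      strict.\<close>
    define N where "N = norm v + norm w + 1"
    have N: "N > 0" by (simp add: N_def add_nonneg_pos)
    define t where "t = min d1 d2 / N"
    have t: "t > 0" using d1 d2 N by (simp add: t_def)
    have near: "dist (x + s *\<^sub>R a + r *\<^sub>R b) x < min d1 d2"
      if "s \<in> {0<..<t}" "r \<in> {0<..<t}" "norm a + norm b + 1 = N" for s r a b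
    proof -
      have "dist (x + s *\<^sub>R a + r *\<^sub>R b) x \<le> s * norm a + r * norm b"
        using that norm_triangle_ineq[of "s *\<^sub>R a" "r *\<^sub>R b"] by (simp add: dist_norm add.assoc)
      also have "\<dots> \<le> t * norm a + t * norm b"
        using that by (intro add_mono mult_right_mono) auto
      also have "\<dots> < t * N" unfolding that(3)[symmetric] using t by (simp add: distrib_left)
      finally show ?thesis using N by (simp add: t_def)
    qed
    obtain s r where sr: "s \<in> {0<..<t}" "r \<in> {0<..<t}" and
      1: "f (x + t *\<^sub>R v + t *\<^sub>R w) - f (x + t *\<^sub>R v) - (f (x + t *\<^sub>R w) - f x) =
        t^2 * D v w (x + s *\<^sub>R v + r *\<^sub>R w)"
      using smooth_second_difference[OF f t, of x v w] unfolding D_def by blast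
    obtain s' r' where sr': "s' \<in> {0<..<t}" "r' \<in> {0<..<t}" and
      2: "f (x + t *\<^sub>R w + t *\<^sub>R v) - f (x + t *\<^sub>R w) - (f (x + t *\<^sub>R v) - f x) =
        t^2 * D w v (x + s' *\<^sub>R w + r' *\<^sub>R v)"
      using smooth_second_difference[OF f t, of x w v] unfolding D_def by blast
    have "t^2 * D v w (x + s *\<^sub>R v + r *\<^sub>R w) = t^2 * D w v (x + s' *\<^sub>R w + r' *\<^sub>R v)"
      unfolding 1[symmetric] 2[symmetric] by (simp add: add_ac)
    then have "D v w (x + s *\<^sub>R v + r *\<^sub>R w) = D w v (x + s' *\<^sub>R w + r' *\<^sub>R v)"
      using t by simp
    moreover have "dist (D v w (x + s *\<^sub>R v + r *\<^sub>R w)) (D v w x) < e/2"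
      using d1(2) near[OF sr, of v w] by (simp add: N_def)
    moreover have "dist (D w v (x + s' *\<^sub>R w + r' *\<^sub>R v)) (D w v x) < e/2"
      using d2(2) near[OF sr', of w v] by (simp add: N_def)
    ultimately show ?thesis unfolding dist_real_def by linarith
  qed
  then have "dist (D v w x) (D w v x) \<le> 0" by (rule field_le_epsilon)
  then show ?thesis by (simp add: D_def)
qed

lemma pd_commute:
  fixes f :: "real^3 \<Rightarrow> real"
  shows "smooth f \<Longrightarrow> pd i (pd j f) = pd j (pd i f)"
  unfolding pd_def[abs_def] fun_eq_iff by (blast intro: frechet_derivative_commute)

lemma frechet_derivative_eq_sum_pd:
  fixes f :: "real^3 \<Rightarrow> real"
  assumes "smooth f"
  shows "frechet_derivative f (at x) v = (\<Sum>i\<in>UNIV. v $ i * pd i f x)"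
proof -
  interpret linear "frechet_derivative f (at x)"
    by (intro linear_frechet_derivative smooth_imp_differentiable assms)
  have "frechet_derivative f (at x) v = frechet_derivative f (at x) (\<Sum>i\<in>UNIV. v $ i *\<^sub>R axis i 1)"
    by (simp add: basis_expansion flip: scalar_mult_eq_scaleR)
  then show ?thesis by (simp add: sum scale pd_def)
qed

lemma laplacian_component:
  assumes "smooth u"
  shows "laplacian (\<lambda>x. u x $ j) = (\<lambda>x. laplacian u x $ j)"
  by (simp add: laplacian_def fun_eq_iff pd_component assms smooth_pd)

lemma smooth_laplacian [smooth_intros]: "smooth f \<Longrightarrow> smooth (laplacian f)"
  unfolding laplacian_def[abs_def] by (intro smooth_intros)

lemma pd_diff: "smooth f \<Longrightarrow> smooth g \<Longrightarrow> pd i (\<lambda>x. f x - g x) = (\<lambda>x. pd i f x - pd i g x)"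
  using pd_add[OF _ smooth_minus, of f g i] by (simp add: pd_minus)

lemma smooth_diff [smooth_intros]: "smooth f \<Longrightarrow> smooth g \<Longrightarrow> smooth (\<lambda>x. f x - g x)"
  using smooth_add[OF _ smooth_minus, of f g] by simp

section \<open>Integration by parts on superlevel sets\<close>

lemma integrable_lborel_compact_support:
  fixes F :: "'a::euclidean_space \<Rightarrow> real"
  assumes "continuous_on UNIV F" and supp: "\<And>x. R < norm x \<Longrightarrow> F x = 0"
  shows "integrable lborel F"
proof -
  have "integrable lborel (\<lambda>x. indicator (cball 0 R) x *\<^sub>R F x)"
    using assms(1) by (intro borel_integrable_compact) (auto intro: continuous_on_subset)
  also have "(\<lambda>x. indicator (cball 0 R) x *\<^sub>R F x) = F"
    using supp by (force simp: indicator_def)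
  finally show ?thesis .
qed

text \<open>The set where \<open>F\<close> is nonzero is open and null, hence empty.\<close>

lemma lborel_AE_eq_continuous:
  fixes F :: "'a::euclidean_space \<Rightarrow> real"
  assumes "AE x in lborel. F x = 0" and "continuous_on UNIV F"
  shows "F x = 0"
proof -
  have "open {x. F x \<noteq> 0}"
    using assms(2) by (intro open_Collect_neq) auto
  moreover have "negligible {x. F x \<noteq> 0}"
    using AE_completion[OF assms(1)]
    by (auto simp: negligible_iff_null_sets eventually_ae_filter null_sets_completion_iff2)
      (meson subset_trans)
  ultimately show ?thesis using open_not_negligible by blast
qed

text \<open>Converts the integral estimates below into pointwise identities.\<close>

lemma nonneg_integral_eq_0_continuous:
  fixes F :: "'a::euclidean_space \<Rightarrow> real"
  assumes "continuous_on UNIV F" "integrable lborel F" "\<And>x. 0 \<le> F x" "integral\<^sup>L lborel F \<le> 0"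
  shows "F x = 0"
proof (rule lborel_AE_eq_continuous[where F = F])
  have "integral\<^sup>L lborel F = 0"
    using assms by (intro antisym integral_nonneg_AE) auto
  then show "AE x in lborel. F x = 0"
    using integral_nonneg_eq_0_iff_AE[of lborel F] assms by auto
qed fact

lemma integral_lborel_translate:
  fixes F :: "'a::euclidean_space \<Rightarrow> real"
  assumes "F \<in> borel_measurable borel"
  shows "(\<integral>x. F (c + x) \<partial>lborel) = integral\<^sup>L lborel F"
  using integral_distr[of "(+) c" lborel borel F] assms by (simp add: lborel_distr_plus)

text \<open>By translation invariance the difference quotients of \<open>F\<close> have integral zero.\<close>

lemma integral_derivative_compact_support:
  fixes F :: "'a::euclidean_space \<Rightarrow> real"
  assumes F: "\<And>x. (F has_derivative F' x) (at x)"
    and cont: "continuous_on UNIV (\<lambda>x. F' x v)"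
    and supp: "\<And>x. R < norm x \<Longrightarrow> F x = 0"
  shows "(\<integral>x. F' x v \<partial>lborel) = 0"
proof -
  have contF: "continuous_on UNIV F"
    using has_derivative_continuous[OF F] by (simp add: continuous_on_eq_continuous_at)
  then have meas: "F \<in> borel_measurable borel"
    by (rule borel_measurable_continuous_onI)
  have int: "integrable lborel F"
    using contF supp by (rule integrable_lborel_compact_support)
  \<comment> \<open>Starting in the ball of radius \<open>R + norm v\<close> and moving by at most
    \<open>v\<close>, one stays in the ball of radius \<open>K\<close>.\<close>
  define K where "K = R + 2 * norm v"
  have "compact ((\<lambda>x. F' x v) ` cball 0 K)"
    using cont by (intro compact_continuous_image) (auto intro: continuous_on_subset)
  then obtain M where "\<forall>y\<in>(\<lambda>x. F' x v) ` cball 0 K. norm y \<le> M"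
    using compact_imp_bounded bounded_iff by blast
  then have M: "\<bar>F' x v\<bar> \<le> M" if "norm x \<le> K" for x
    using that by auto
  define t where "t n = inverse (real (Suc n))" for n
  have t: "0 < t n" "t n \<le> 1" for n
    by (auto simp: t_def inverse_le_1_iff)
  define s where "s n x = (F (t n *\<^sub>R v + x) - F x) / t n" for n x
  have line: "((\<lambda>r. F (r *\<^sub>R v + x)) has_real_derivative F' (r *\<^sub>R v + x) v) (at r)" for r x
  proof -
    have "((\<lambda>r. F (r *\<^sub>R v + x)) has_derivative (\<lambda>h. F' (r *\<^sub>R v + x) (h *\<^sub>R v))) (at r)"
      by (rule has_derivative_compose[OF _ F]) (auto intro!: derivative_eq_intros)
    moreover have "(\<lambda>h. F' (r *\<^sub>R v + x) (h *\<^sub>R v)) = (\<lambda>h. F' (r *\<^sub>R v + x) v * h)"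
      using has_derivative_linear[OF F] by (auto simp: linear_cmul)
    ultimately show ?thesis by (simp add: has_field_derivative_def)
  qed
  \<comment> \<open>A majorant common to all \<open>n\<close>: the mean value theorem inside the
    enlarged ball, while outside it both values of \<open>F\<close> in the quotient vanish.\<close>
  have bound: "\<bar>s n x\<bar> \<le> indicator (cball 0 (R + norm v)) x * M" for n x
  proof (cases "norm x \<le> R + norm v")
    case True
    from MVT2[OF t(1) line, of n x] obtain r where r: "0 < r" "r < t n"
      "F (t n *\<^sub>R v + x) - F x = t n * F' (r *\<^sub>R v + x) v" by auto
    have "norm (r *\<^sub>R v + x) \<le> r * norm v + norm x"
      using norm_triangle_ineq[of "r *\<^sub>R v" x] r by simp
    also have "\<dots> \<le> 1 * norm v + (R + norm v)"
      using r t(2)[of n] True by (intro add_mono mult_right_mono) auto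
    finally have "norm (r *\<^sub>R v + x) \<le> K" by (simp add: K_def)
    from M[OF this] show ?thesis
      using True r t(1)[of n] by (simp add: s_def)
  next
    case False
    have "norm (t n *\<^sub>R v) \<le> norm v"
      using t[of n] by (simp add: mult_left_le_one_le)
    then have "R < norm (t n *\<^sub>R v + x)"
      using False norm_diff_ineq[of x "t n *\<^sub>R v"] by (simp add: add.commute)
    moreover have "R < norm x" using False norm_ge_zero[of v] by linarith
    ultimately show ?thesis using False by (simp add: s_def supp)
  qed
  have "(\<lambda>n. integral\<^sup>L lborel (s n)) \<longlonglongrightarrow> (\<integral>x. F' x v \<partial>lborel)"
  proof (rule integral_dominated_convergence)
    show "(\<lambda>x. F' x v) \<in> borel_measurable lborel"
      using cont by (simp add: borel_measurable_continuous_onI)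
    show "s n \<in> borel_measurable lborel" for n
      using meas unfolding s_def by measurable
    show "integrable lborel (\<lambda>x::'a. indicator (cball 0 (R + norm v)) x * M)"
      by (intro integrable_mult_left integrable_real_indicator emeasure_bounded_finite) auto
    show "AE x in lborel. norm (s n x) \<le> indicator (cball 0 (R + norm v)) x * M" for n
      using bound by simp
    show "AE x in lborel. (\<lambda>n. s n x) \<longlonglongrightarrow> F' x v"
    proof (rule AE_I2)
      fix x
      have "((\<lambda>h. (F (h *\<^sub>R v + x) - F x) / h) \<longlongrightarrow> F' x v) (at 0)"
        using line[of x 0] by (simp add: DERIV_def)
      moreover have "filterlim t (at 0) sequentially"
        unfolding filterlim_at t_def
        using LIMSEQ_inverse_real_of_nat by (auto intro!: always_eventually)
      ultimately show "(\<lambda>n. s n x) \<longlonglongrightarrow> F' x v"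
        unfolding s_def by (rule filterlim_compose)
    qed
  qed
  moreover have "integral\<^sup>L lborel (s n) = 0" for n
  proof -
    have "integrable lborel (\<lambda>x. F (t n *\<^sub>R v + x))"
      using int meas integrable_distr_eq[of "(+) (t n *\<^sub>R v)" lborel borel F]
      by (simp add: lborel_distr_plus)
    then show ?thesis
      using int by (simp add: s_def[abs_def] integral_lborel_translate[OF meas])
  qed
  ultimately show ?thesis
    using LIMSEQ_unique[OF _ tendsto_const] by simp
qed

text \<open>For \<open>t < 0\<close> the interval \<open>{0..t}\<close> is empty and the integral is
  0, which matches \<open>h\<close> vanishing there. Moving the lower endpoint to \<open>a\<close>,
  left of both 0 and \<open>t\<close>, therefore changes nothing and makes \<open>t\<close> an
  interior point.\<close>

lemma has_real_derivative_integral_from_0: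
  fixes h :: "real \<Rightarrow> real"
  assumes h: "continuous_on UNIV h" and zero: "\<And>t. t \<le> 0 \<Longrightarrow> h t = 0"
  shows "((\<lambda>t. integral {0..t} h) has_real_derivative h t) (at t)"
proof -
  define a where "a = min t 0 - 1"
  have eq: "integral {a..s} h = integral {0..s} h" if "a < s" for s
  proof (cases "s \<le> 0")
    case True
    then have "integral {a..s} h = integral {a..s} (\<lambda>_. 0)"
      by (intro integral_cong) (simp add: zero)
    moreover from True have "integral {0..s} h = integral {0..s} (\<lambda>_. 0)"
      by (intro integral_cong) (simp add: zero)
    ultimately show ?thesis by simp
  next
    case False
    have "integral {a..0} h = integral {a..0} (\<lambda>_. 0)"
      by (intro integral_cong) (simp add: zero)
    moreover have "integral {a..0} h + integral {0..s} h = integral {a..s} h"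
      using False by (intro Henstock_Kurzweil_Integration.integral_combine integrable_continuous_interval
        continuous_on_subset[OF h]) (auto simp: a_def)
    ultimately show ?thesis by simp
  qed
  have "((\<lambda>s. integral {a..s} h) has_real_derivative h t) (at t within {a..t+1})"
    by (rule integral_has_real_derivative) (auto simp: a_def intro: continuous_on_subset[OF h])
  then have "((\<lambda>s. integral {a..s} h) has_real_derivative h t) (at t)"
    by (simp add: at_within_Icc_at a_def)
  moreover have ev: "\<forall>\<^sub>F s in nhds t. integral {a..s} h = integral {0..s} h"
    by (rule eventually_mono[OF eventually_nhds_in_open[OF open_greaterThan[of a]]])
      (auto intro: eq, simp add: a_def)
  ultimately show ?thesis
    by (simp add: DERIV_cong_ev[OF refl ev refl])
qed

lemma integral_from_0_eq_0:
  fixes h :: "real \<Rightarrow> real"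
  assumes "\<And>t. t \<le> e \<Longrightarrow> h t = 0" "t \<le> e"
  shows "integral {0..t} h = 0"
proof -
  have "integral {0..t} h = integral {0..t} (\<lambda>_. 0)"
    using assms by (intro integral_cong) auto
  then show ?thesis by simp
qed

lemma tendsto_0_at_infinity_bound:
  fixes f :: "'a::real_normed_vector \<Rightarrow> real"
  assumes "(f \<longlongrightarrow> 0) at_infinity" "e > 0"
  obtains R where "\<And>x. R < norm x \<Longrightarrow> \<bar>f x\<bar> < e"
proof -
  from assms obtain b where "\<And>x. b \<le> norm x \<Longrightarrow> dist (f x) 0 < e"
    unfolding tendsto_iff eventually_at_infinity by blast
  then show thesis by (intro that[of b]) auto
qed

text \<open>Decay confines the set where \<open>f\<close> exceeds \<open>e\<close> to a ball, so the
  cutoff \<open>h\<close> gives the integrand compact support, whatever the growth of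
  \<open>g\<close>.\<close>

lemma integrable_level:
  fixes f g :: "real^3 \<Rightarrow> real"
  assumes "continuous_on UNIV f" "continuous_on UNIV g" and lim: "(f \<longlongrightarrow> 0) at_infinity"
    and e: "0 < e" and zero: "\<And>t. t \<le> e \<Longrightarrow> h t = 0" and h: "continuous_on UNIV h"
  shows "integrable lborel (\<lambda>x. h (f x) * g x)"
proof -
  obtain R where R: "\<And>x. R < norm x \<Longrightarrow> \<bar>f x\<bar> < e"
    using tendsto_0_at_infinity_bound[OF lim e] by blast
  show ?thesis
  proof (rule integrable_lborel_compact_support)
    show "h (f x) * g x = 0" if "R < norm x" for x
      using zero[of "f x"] R[OF that] by simp
    show "continuous_on UNIV (\<lambda>x. h (f x) * g x)"
      using assms(1,2) by (intro continuous_intros continuous_on_compose2[OF h]) auto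
  qed
qed

text \<open>The integrand is the \<open>i\<close>-th partial derivative of
  \<open>\<psi> (f x) * g x\<close>, a function of compact support.\<close>

lemma integral_by_parts_level:
  fixes f g :: "real^3 \<Rightarrow> real"
  assumes f: "smooth f" and g: "smooth g" and lim: "(f \<longlongrightarrow> 0) at_infinity"
    and e: "0 < e" and zero: "\<And>t. t \<le> e \<Longrightarrow> \<psi> t = 0" "\<And>t. t \<le> e \<Longrightarrow> h t = 0"
    and \<psi>: "\<And>t. (\<psi> has_real_derivative h t) (at t)" and h: "continuous_on UNIV h"
  shows "has_bochner_integral lborel (\<lambda>x. h (f x) * (pd i f x * g x) + \<psi> (f x) * pd i g x) 0"
proof -
  obtain R where R: "\<And>x. R < norm x \<Longrightarrow> \<bar>f x\<bar> < e"
    using tendsto_0_at_infinity_bound[OF lim e] by blast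
  define F' where "F' x = (\<lambda>v. \<psi> (f x) * frechet_derivative g (at x) v +
    (h (f x) * frechet_derivative f (at x) v) * g x)" for x
  have c\<psi>: "continuous_on UNIV \<psi>"
    using \<psi> by (auto simp: continuous_on_eq_continuous_at intro: DERIV_isCont)
  have "(\<integral>x. F' x (axis i 1) \<partial>lborel) = 0"
  proof (rule integral_derivative_compact_support)
    show "((\<lambda>x. \<psi> (f x) * g x) has_derivative F' x) (at x)" for x
      unfolding F'_def
      by (intro has_derivative_mult has_derivative_compose[OF smooth_has_derivative[OF f]]
        smooth_has_derivative[OF g] \<psi>[unfolded has_field_derivative_def])
    show "\<psi> (f x) * g x = 0" if "R < norm x" for x
      using zero(1)[of "f x"] R[OF that] by simp
    show "continuous_on UNIV (\<lambda>x. F' x (axis i 1))"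
      unfolding F'_def
      by (intro continuous_intros continuous_on_compose2[OF h] continuous_on_compose2[OF c\<psi>]
        smooth_imp_continuous_on f g smooth_frechet_derivative) auto
  qed
  moreover have "integrable lborel (\<lambda>x. h (f x) * (pd i f x * g x) + \<psi> (f x) * pd i g x)"
    by (intro Bochner_Integration.integrable_add integrable_level[OF _ _ lim e zero(1) c\<psi>]
      integrable_level[OF _ _ lim e zero(2) h] smooth_imp_continuous_on f g smooth_intros)
  ultimately show ?thesis
    by (simp add: has_bochner_integral_iff F'_def pd_def algebra_simps)
qed

section \<open>Energy identity and maximum principle\<close>

text \<open>The expression \<open>laplacian f - v . grad f\<close> is tested with a primitive of
  \<open>h\<close> evaluated at \<open>f\<close>; the Laplacian produces the gradient term, and
  transport by a divergence-free field integrates to zero.\<close>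

lemma energy_identity:
  fixes f :: "real^3 \<Rightarrow> real" and v :: "3 \<Rightarrow> real^3 \<Rightarrow> real"
  assumes f: "smooth f" and v: "\<And>i. smooth (v i)" and lim: "(f \<longlongrightarrow> 0) at_infinity"
    and div: "\<And>x. (\<Sum>i\<in>UNIV. pd i (v i) x) = 0"
    and e: "0 < e" and zero: "\<And>t. t \<le> e \<Longrightarrow> h t = 0" and h: "continuous_on UNIV h"
  shows "has_bochner_integral lborel (\<lambda>x. h (f x) * (\<Sum>i\<in>UNIV. (pd i f x)\<^sup>2) +
    integral {0..f x} h * (laplacian f x - (\<Sum>i\<in>UNIV. v i x * pd i f x))) 0"
proof -
  define \<psi> where "\<psi> t = integral {0..t} h" for t
  \<comment> \<open>The second primitive writes the transport term as a divergence:
    \<open>\<psi> (f)\<close> times \<open>v . grad f\<close> is the divergence of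
    \<open>\<Psi> (f) v\<close>.\<close>
  define \<Psi> where "\<Psi> t = integral {0..t} \<psi>" for t
  have \<psi>: "(\<psi> has_real_derivative h t) (at t)" for t
    unfolding \<psi>_def using e by (intro has_real_derivative_integral_from_0 h zero) auto
  have zero\<psi>: "\<psi> t = 0" if "t \<le> e" for t
    unfolding \<psi>_def using zero that by (rule integral_from_0_eq_0)
  have c\<psi>: "continuous_on UNIV \<psi>"
    using \<psi> by (auto simp: continuous_on_eq_continuous_at intro: DERIV_isCont)
  have \<Psi>: "(\<Psi> has_real_derivative \<psi> t) (at t)" for t
    unfolding \<Psi>_def using e by (intro has_real_derivative_integral_from_0 c\<psi> zero\<psi>) auto
  have zero\<Psi>: "\<Psi> t = 0" if "t \<le> e" for t
    unfolding \<Psi>_def using zero\<psi> that by (rule integral_from_0_eq_0)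
  \<comment> \<open>This sum is the divergence of \<open>\<psi> (f) grad f\<close>; the next one is
    that of \<open>\<Psi> (f) v\<close>.\<close>
  have "has_bochner_integral lborel
      (\<lambda>x. \<Sum>i\<in>UNIV. h (f x) * (pd i f x * pd i f x) + \<psi> (f x) * pd i (pd i f) x) (\<Sum>i\<in>(UNIV::3 set). 0)"
    by (intro has_bochner_integral_sum integral_by_parts_level[OF f _ lim e zero\<psi> zero \<psi> h]
      smooth_intros f)
  moreover have "has_bochner_integral lborel
      (\<lambda>x. \<Sum>i\<in>UNIV. \<psi> (f x) * (pd i f x * v i x) + \<Psi> (f x) * pd i (v i) x) (\<Sum>i\<in>(UNIV::3 set). 0)"
    by (intro has_bochner_integral_sum integral_by_parts_level[OF f _ lim e zero\<Psi> zero\<psi> \<Psi> c\<psi>] v)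
  ultimately have "has_bochner_integral lborel
      (\<lambda>x. (\<Sum>i\<in>UNIV. h (f x) * (pd i f x * pd i f x) + \<psi> (f x) * pd i (pd i f) x) -
      (\<Sum>i\<in>UNIV. \<psi> (f x) * (pd i f x * v i x) + \<Psi> (f x) * pd i (v i) x))
      ((\<Sum>i\<in>(UNIV::3 set). 0) - (\<Sum>i\<in>(UNIV::3 set). 0))"
    by (rule has_bochner_integral_diff)
  also have "(\<lambda>x. (\<Sum>i\<in>UNIV. h (f x) * (pd i f x * pd i f x) + \<psi> (f x) * pd i (pd i f) x) -
      (\<Sum>i\<in>UNIV. \<psi> (f x) * (pd i f x * v i x) + \<Psi> (f x) * pd i (v i) x)) =
    (\<lambda>x. h (f x) * (\<Sum>i\<in>UNIV. (pd i f x)\<^sup>2) +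
      integral {0..f x} h * (laplacian f x - (\<Sum>i\<in>UNIV. v i x * pd i f x)))"
    by (simp add: sum.distrib power2_eq_square laplacian_def \<psi>_def div mult.commute
      right_diff_distrib flip: sum_distrib_left) (simp add: sum_distrib_left mult_ac add_diff_eq)
  finally show ?thesis by simp
qed

text \<open>A weak maximum principle: with \<open>h\<close> the positive part of
  \<open>t - e\<close>, both terms of the energy identity are nonnegative, so both vanish. The
  differential inequality is asked for only where \<open>f\<close> is positive because the test
  function vanishes elsewhere; this form is what allows a later application to
  \<open>-Q\<close>.\<close>

lemma decaying_subsolution_nonpos:
  fixes f :: "real^3 \<Rightarrow> real" and v :: "3 \<Rightarrow> real^3 \<Rightarrow> real"
  assumes f: "smooth f" and v: "\<And>i. smooth (v i)" and lim: "(f \<longlongrightarrow> 0) at_infinity"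
    and div: "\<And>x. (\<Sum>i\<in>UNIV. pd i (v i) x) = 0"
    and sub: "\<And>x. 0 < f x \<Longrightarrow> (\<Sum>i\<in>UNIV. v i x * pd i f x) \<le> laplacian f x"
  shows "f x \<le> 0"
proof -
  have "f x \<le> 0 + e" if e: "0 < e" for e
  proof (rule ccontr)
    assume "\<not> f x \<le> 0 + e"
    then have fx: "e < f x" by simp
    define h :: "real \<Rightarrow> real" where "h t = max 0 (t - e)" for t
    have h: "continuous_on UNIV h" unfolding h_def by (intro continuous_intros)
    have zero: "h t = 0" if "t \<le> e" for t using that by (simp add: h_def)
    have nonneg: "0 \<le> h t" for t by (simp add: h_def)
    define \<psi> where "\<psi> t = integral {0..t} h" for t
    have \<psi>: "(\<psi> has_real_derivative h t) (at t)" for t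
      unfolding \<psi>_def using e by (intro has_real_derivative_integral_from_0 h zero) auto
    have zero\<psi>: "\<psi> t = 0" if "t \<le> e" for t
      unfolding \<psi>_def using zero that by (rule integral_from_0_eq_0)
    have nonneg\<psi>: "0 \<le> \<psi> t" for t
      unfolding \<psi>_def using nonneg h
      by (intro integral_nonneg integrable_continuous_interval) (auto intro: continuous_on_subset)
    have c\<psi>: "continuous_on UNIV \<psi>"
      using \<psi> by (auto simp: continuous_on_eq_continuous_at intro: DERIV_isCont)
    define D where "D x = laplacian f x - (\<Sum>i\<in>UNIV. v i x * pd i f x)" for x
    define F where "F x = h (f x) * (\<Sum>i\<in>UNIV. (pd i f x)\<^sup>2) + \<psi> (f x) * D x" for x
    have D: "0 \<le> \<psi> (f y) * D y" for y
    proof (cases "0 < f y")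
      case True
      with sub[of y] nonneg\<psi>[of "f y"] show ?thesis by (simp add: D_def)
    qed (use zero\<psi>[of "f y"] e in auto)
    have G: "0 \<le> h (f y) * (\<Sum>i\<in>UNIV. (pd i f y)\<^sup>2)" for y
      using nonneg by (simp add: sum_nonneg)
    have intF: "has_bochner_integral lborel F 0"
      using energy_identity[OF f v lim div e zero h] unfolding F_def D_def \<psi>_def .
    have contF: "continuous_on UNIV F"
      unfolding F_def D_def laplacian_def
      by (intro continuous_intros continuous_on_compose2[OF h] continuous_on_compose2[OF c\<psi>]
        smooth_imp_continuous_on f v smooth_pd) auto
    have "F y = 0" for y
    proof (rule nonneg_integral_eq_0_continuous[OF contF])
      show "integrable lborel F" "integral\<^sup>L lborel F \<le> 0"
        using intF by (auto simp: has_bochner_integral_iff)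
      show "0 \<le> F z" for z using D[of z] G[of z] by (simp add: F_def)
    qed
    then have "h (f y) * (\<Sum>i\<in>UNIV. (pd i f y)\<^sup>2) = 0" for y
      using D[of y] G[of y] unfolding F_def by (metis add_nonneg_eq_0_iff)
    then have "h (f y) = 0 \<or> (\<forall>i. pd i f y = 0)" for y
      by (simp add: sum_nonneg_eq_0_iff)
    then have pd0: "h (f y) * pd i f y = 0" for y i
      using mult_eq_0_iff by blast
    \<comment> \<open>The gradient of \<open>\<psi> (f)\<close> is \<open>h (f) grad f\<close>,
      which has just been shown to vanish, so \<open>\<psi> (f)\<close> is constant.\<close>
    have "((\<lambda>x. \<psi> (f x)) has_derivative (\<lambda>_. 0)) (at y within UNIV)" for y
    proof -
      have "((\<lambda>x. \<psi> (f x)) has_derivative (\<lambda>v. h (f y) * frechet_derivative f (at y) v)) (at y)"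
        by (rule has_derivative_compose[OF smooth_has_derivative[OF f]])
          (rule \<psi>[unfolded has_field_derivative_def])
      moreover have "h (f y) * frechet_derivative f (at y) v = 0" for v
      proof -
        have "h (f y) * frechet_derivative f (at y) v = (\<Sum>i\<in>UNIV. v $ i * (h (f y) * pd i f y))"
          by (simp add: frechet_derivative_eq_sum_pd[OF f] sum_distrib_left mult_ac)
        then show ?thesis by (simp only: pd0) simp
      qed
      ultimately show ?thesis by simp
    qed
    then have "\<exists>c. \<forall>y\<in>UNIV. \<psi> (f y) = c"
      by (intro has_derivative_zero_constant) auto
    then obtain c where c: "\<And>y. \<psi> (f y) = c" by auto
    obtain R where R: "\<And>x. R < norm x \<Longrightarrow> \<bar>f x\<bar> < e"
      using tendsto_0_at_infinity_bound[OF lim e] by blast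
    \<comment> \<open>The constant is read off at a point far out, where \<open>f\<close> is below
      \<open>e\<close> and hence \<open>\<psi> (f)\<close> is 0.\<close>
    obtain y :: "real^3" where "norm y = \<bar>R\<bar> + 1"
      using vector_choose_size[of "\<bar>R\<bar> + 1"] by auto
    then have "\<bar>f y\<bar> < e" by (intro R) linarith
    then have "\<psi> (f y) = 0" by (intro zero\<psi>) auto
    then have "\<psi> (f x) = 0" using c by simp
    \<comment> \<open>A continuous nonnegative function with zero integral over
      \<open>{0..f x}\<close> vanishes on the whole interval, in particular at its right
      endpoint.\<close>
    then have "h (f x) = 0"
      using integral_eq_0_iff[OF continuous_on_subset[OF h], of 0 "f x"] fx e nonneg
      unfolding \<psi>_def by auto
    then show False using fx by (simp add: h_def)
  qed
  then show ?thesis by (rule field_le_epsilon)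
qed

section \<open>Integrability of the data\<close>

lemma ennreal_inverse_inverse: "inverse (inverse x) = (x::ennreal)"
proof (cases x)
  case (real y)
  then show ?thesis by (cases "y = 0") (simp_all add: inverse_ennreal)
qed simp

text \<open>Hoelder's inequality in qualitative form. For finite exponents, Young's inequality with
  the conjugate pair \<open>q/2\<close>, \<open>r/2\<close> gives a pointwise integrable majorant of
  the squared product.\<close>

lemma in_Lp_mult_square_integrable:
  fixes q r :: ennreal
  assumes A: "in_Lp M q A" and B: "in_Lp M r B"
    and qr: "2 \<le> q" "2 \<le> r" "1 / q + 1 / r = 1 / 2"
  shows "integrable M (\<lambda>x. (A x * B x)\<^sup>2)"
proof -
  \<comment> \<open>If one exponent is infinite, the other is 2, and the essentially bounded factor
    is estimated by a constant \<open>c\<close>.\<close>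
  have endpoint: "integrable M (\<lambda>x. (A x * B x)\<^sup>2)"
    if A: "in_Lp M \<infinity> A" and B: "in_Lp M r B" and r: "1 / r = 1 / 2" for A B and r :: ennreal
  proof -
    have "inverse r = inverse 2" using r by (simp add: divide_ennreal_def)
    then have "inverse (inverse r) = inverse (inverse 2)" by (rule arg_cong)
    then have "r = 2" by (simp only: ennreal_inverse_inverse)
    then have "integrable M (\<lambda>x. \<bar>B x\<bar> powr 2)"
      using B by (simp add: in_Lp_def)
    then have B2: "integrable M (\<lambda>x. (B x)\<^sup>2)" by simp
    have [measurable]: "A \<in> borel_measurable M" "B \<in> borel_measurable M"
      using A B by (auto simp: in_Lp_def)
    have "esssup M (\<lambda>x. ereal \<bar>A x\<bar>) < \<infinity>" using A by (simp add: in_Lp_def)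
    then obtain c where c: "esssup M (\<lambda>x. ereal \<bar>A x\<bar>) < ereal c"
      using ereal_dense2 by blast
    have "AE x in M. \<bar>A x\<bar> \<le> c"
      using esssup_AE[of "\<lambda>x. ereal \<bar>A x\<bar>" M]
    proof eventually_elim
      case (elim x)
      then have "ereal \<bar>A x\<bar> < ereal c" using c by (rule le_less_trans)
      then show ?case by simp
    qed
    then have "AE x in M. norm ((A x * B x)\<^sup>2) \<le> norm (c\<^sup>2 * (B x)\<^sup>2)"
    proof eventually_elim
      case (elim x)
      then have "(A x)\<^sup>2 \<le> c\<^sup>2" using abs_le_square_iff by fastforce
      then show ?case by (simp add: power_mult_distrib mult_right_mono)
    qed
    moreover have "integrable M (\<lambda>x. c\<^sup>2 * (B x)\<^sup>2)"
      using B2 by simp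
    ultimately show ?thesis
      by (rule Bochner_Integration.integrable_bound[rotated 2]) measurable
  qed
  consider "q = \<infinity>" | "r = \<infinity>" | "q \<noteq> \<infinity> \<and> r \<noteq> \<infinity>" by argo
  then show ?thesis
  proof cases
    case 1
    then show ?thesis using endpoint[where A = A and B = B and r = r] A B qr(3) by simp
  next
    case 2
    then show ?thesis using endpoint[where A = B and B = A and r = q] A B qr(3) by (simp add: mult.commute)
  next
    case 3
    then have 3: "q \<noteq> \<infinity>" "r \<noteq> \<infinity>" by simp_all
    define q' r' where "q' = enn2real q" and "r' = enn2real r"
    have q: "q = ennreal q'" and r: "r = ennreal r'"
      using 3 by (simp_all add: q'_def r'_def less_top)
    have q': "2 \<le> q'" and r': "2 \<le> r'"
      using qr(1,2) 3 enn2real_mono[of 2 q] enn2real_mono[of 2 r]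
      by (auto simp: q'_def r'_def less_top)
    have "ennreal (1 / q' + 1 / r') = ennreal (1 / 2)"
      using qr(3) q' r' unfolding q r
      by (simp add: divide_ennreal ennreal_plus flip: ennreal_1 ennreal_numeral)
    then have eq: "1 / q' + 1 / r' = 1 / 2"
      using q' r' by (subst (asm) ennreal_inj) auto
    \<comment> \<open>An exponent equal to 2 would make the reciprocal of the other one 0, which is
      impossible for a finite exponent. Young's inequality needs the halved exponents strictly above
      1.\<close>
    have "q' \<noteq> 2" "r' \<noteq> 2" using eq r' q' by auto
    then have gt: "1 < q' / 2" "1 < r' / 2" using q' r' by auto
    have conj: "1 / (q' / 2) + 1 / (r' / 2) = 1"
      using eq by (simp add: field_simps)
    have iA: "integrable M (\<lambda>x. \<bar>A x\<bar> powr q')" and iB: "integrable M (\<lambda>x. \<bar>B x\<bar> powr r')"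
      and [measurable]: "A \<in> borel_measurable M" "B \<in> borel_measurable M"
      using A B 3 by (auto simp: in_Lp_def q'_def r'_def)
    have "(A x * B x)\<^sup>2 \<le> \<bar>A x\<bar> powr q' / (q' / 2) + \<bar>B x\<bar> powr r' / (r' / 2)" for x
    proof -
      have pw: "(y\<^sup>2) powr (s / 2) = \<bar>y\<bar> powr s" for y s :: real
        using powr_powr[of "\<bar>y\<bar>" 2 "s/2"] by simp
      show ?thesis
        using Youngs_inequality[OF gt conj, of "(A x)\<^sup>2" "(B x)\<^sup>2"]
        by (simp add: power_mult_distrib pw)
    qed
    then have "norm ((A x * B x)\<^sup>2) \<le> norm (\<bar>A x\<bar> powr q' / (q' / 2) + \<bar>B x\<bar> powr r' / (r' / 2))" for x
      by (metis abs_ge_self abs_of_nonneg order_trans real_norm_def zero_le_power2)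
    moreover have "integrable M (\<lambda>x. \<bar>A x\<bar> powr q' / (q' / 2) + \<bar>B x\<bar> powr r' / (r' / 2))"
      using iA iB by (intro Bochner_Integration.integrable_add integrable_divide_zero) auto
    ultimately show ?thesis
      by (rule Bochner_Integration.integrable_bound[rotated 2, OF AE_I2]) measurable
  qed
qed

text \<open>Used contrapositively: divergence of the improper integral makes the proper integrals
  over \<open>{e..s}\<close> unbounded. Monotone convergence handles \<open>{0<..s}\<close>, and
  monotonicity of \<open>\<xi>\<close> bounds the integrand by \<open>1 / \<xi> s\<close> beyond
  \<open>s\<close>.\<close>

lemma nn_integral_inverse_le:
  fixes \<xi> :: "real \<Rightarrow> real"
  assumes cont: "continuous_on {0..} \<xi>" and mono: "mono_on {0..} \<xi>" and pos: "\<And>s. s > 0 \<Longrightarrow> \<xi> s > 0"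
    and s: "0 < s" and le: "\<And>e. 0 < e \<Longrightarrow> e < s \<Longrightarrow> integral {e..s} (\<lambda>t. 1 / \<xi> t) \<le> C"
  shows "(\<integral>\<^sup>+t\<in>{0<..<1}. ennreal (1 / \<xi> t) \<partial>lebesgue) \<le> ennreal C + ennreal (1 / \<xi> s)"
proof -
  let ?g = "\<lambda>t. ennreal (1 / \<xi> t)"
  have g_int: "(\<lambda>t. 1 / \<xi> t) integrable_on {e..s}" if "0 < e" for e
    using that pos by (intro integrable_continuous_interval continuous_intros continuous_on_subset[OF cont])
      (auto simp: less_imp_neq[symmetric] dest: less_le_trans)
  have meas: "(\<lambda>t. ?g t * indicator {e..s} t) \<in> borel_measurable borel" if "0 < e" for e
  proof -
    have "continuous_on {e..s} (\<lambda>t. 1 / \<xi> t)"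
      using that pos by (intro continuous_intros continuous_on_subset[OF cont])
        (auto simp: less_imp_neq[symmetric] dest: less_le_trans)
    then have "(\<lambda>t. indicator {e..s} t *\<^sub>R (1 / \<xi> t)) \<in> borel_measurable borel"
      by (intro borel_measurable_continuous_on_indicator) auto
    then have "(\<lambda>t. ennreal (indicator {e..s} t *\<^sub>R (1 / \<xi> t))) \<in> borel_measurable borel"
      by measurable
    also have "(\<lambda>t. ennreal (indicator {e..s} t *\<^sub>R (1 / \<xi> t))) = (\<lambda>t. ?g t * indicator {e..s} t)"
      by (auto simp: fun_eq_iff indicator_def)
    finally show ?thesis .
  qed
  \<comment> \<open>The shift by 2 keeps \<open>e n\<close> strictly below \<open>s\<close> already
    for \<open>n = 0\<close>.\<close>
  define e where "e n = s / real (n + 2)" for n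
  have e: "0 < e n" "e n < s" for n using s by (auto simp: e_def field_simps add_pos_nonneg)
  have e_mono: "e m \<le> e n" if "n \<le> m" for m n
    using s that by (auto simp: e_def intro!: divide_left_mono)
  have inc: "incseq (\<lambda>n t. ?g t * indicator {e n..s} t)"
    using e_mono by (auto simp: incseq_def le_fun_def indicator_def intro: order_trans)
  have "(\<integral>\<^sup>+t. ?g t * indicator {0<..s} t \<partial>lborel) = (\<integral>\<^sup>+t. (SUP n. ?g t * indicator {e n..s} t) \<partial>lborel)"
  proof (intro nn_integral_cong antisym SUP_least)
    fix t
    show "?g t * indicator {0<..s} t \<le> (SUP n. ?g t * indicator {e n..s} t)"
    proof (cases "0 < t \<and> t \<le> s")
      case True
      obtain n where "s / t < real n" using reals_Archimedean2 by blast
      then have "e n \<le> t" using True by (simp add: e_def field_simps)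
      then show ?thesis using True by (intro SUP_upper2[of n]) auto
    qed auto
  next
    fix t n
    show "?g t * indicator {e n..s} t \<le> ?g t * indicator {0<..s} t"
      using e(1)[of n] by (auto simp: indicator_def)
  qed
  also have "\<dots> = (SUP n. \<integral>\<^sup>+t. ?g t * indicator {e n..s} t \<partial>lborel)"
    using meas e by (intro nn_integral_monotone_convergence_SUP inc) auto
  also have "\<dots> \<le> ennreal C"
  proof (rule SUP_least)
    fix n
    have "(\<integral>\<^sup>+t. ?g t * indicator {e n..s} t \<partial>lborel) = ennreal (integral {e n..s} (\<lambda>t. 1 / \<xi> t))"
      using pos e(1)[of n]
      by (intro nn_integral_has_integral_lebesgue' integrable_integral g_int)
        (auto intro!: less_imp_le)
    then show "(\<integral>\<^sup>+t. ?g t * indicator {e n..s} t \<partial>lborel) \<le> ennreal C"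
      using le[OF e] by (simp add: ennreal_leI)
  qed
  finally have 1: "(\<integral>\<^sup>+t. ?g t * indicator {0<..s} t \<partial>lborel) \<le> ennreal C" .
  have "(\<integral>\<^sup>+t\<in>{0<..<1}. ?g t \<partial>lebesgue) = (\<integral>\<^sup>+t\<in>{0<..<1}. ?g t \<partial>lborel)"
    by (simp add: nn_integral_completion)
  also have "\<dots> \<le> (\<integral>\<^sup>+t. ?g t * indicator {0<..s} t + ennreal (1 / \<xi> s) * indicator {0<..<1} t \<partial>lborel)"
  proof (intro nn_integral_mono)
    fix t
    have "1 / \<xi> t \<le> 1 / \<xi> s" if "s < t"
      using that s pos[of s] mono_onD[OF mono, of s t] by (intro divide_left_mono) auto
    then show "?g t * indicator {0<..<1} t
        \<le> ?g t * indicator {0<..s} t + ennreal (1 / \<xi> s) * indicator {0<..<1} t"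
      by (auto simp: indicator_def intro: ennreal_leI)
  qed
  also have "\<dots> = (\<integral>\<^sup>+t. ?g t * indicator {0<..s} t \<partial>lborel)
      + (\<integral>\<^sup>+t. ennreal (1 / \<xi> s) * indicator {0<..<1::real} t \<partial>lborel)"
  proof (rule nn_integral_add)
    have "continuous_on {0<..s} (\<lambda>t. 1 / \<xi> t)"
      using pos by (intro continuous_intros continuous_on_subset[OF cont])
        (auto simp: less_imp_neq[symmetric])
    then have "(\<lambda>t. indicator {0<..s} t *\<^sub>R (1 / \<xi> t)) \<in> borel_measurable borel"
      by (intro borel_measurable_continuous_on_indicator) auto
    then have "(\<lambda>t. ennreal (indicator {0<..s} t *\<^sub>R (1 / \<xi> t))) \<in> borel_measurable borel"
      by measurable
    also have "(\<lambda>t. ennreal (indicator {0<..s} t *\<^sub>R (1 / \<xi> t))) = (\<lambda>t. ?g t * indicator {0<..s} t)"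
      by (auto simp: fun_eq_iff indicator_def)
    finally show "(\<lambda>t. ?g t * indicator {0<..s} t) \<in> borel_measurable lborel" by simp
  qed auto
  also have "(\<integral>\<^sup>+t. ennreal (1 / \<xi> s) * indicator {0<..<1::real} t \<partial>lborel) = ennreal (1 / \<xi> s)"
    by (simp add: nn_integral_cmult)
  finally show ?thesis using 1 by (meson add_right_mono order_trans)
qed

section \<open>Vorticity and head pressure\<close>

text \<open>The parts along \<open>n\<close> drop out because a scalar triple product with two
  parallel factors vanishes.\<close>

lemma cross3_tangential:
  fixes v w n :: "real^3"
  assumes "norm n = 1"
  shows "cross3 (v - (v \<bullet> n) *\<^sub>R n) (w - (w \<bullet> n) *\<^sub>R n) \<bullet> n = cross3 v w \<bullet> n"
  by (simp add: cross3_def inner_vec_def sum_3 vector_3 algebra_simps)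

section \<open>Differential identities for the head pressure and the vorticity, and their integral
  consequences\<close>

locale Navier_Stokes_solution =
  fixes u :: "real^3 \<Rightarrow> real^3" and p :: "real^3 \<Rightarrow> real"
  assumes smooth_u: "smooth u" and smooth_p: "smooth p"
    and equation: "stationary_Navier_Stokes u p"
begin

definition U :: "3 \<Rightarrow> real^3 \<Rightarrow> real" where "U i x = u x $ i"
text \<open>The vorticity as an antisymmetric matrix, suited to index computations: the components
  of \<open>curl u\<close> are \<open>W 2 3\<close>, \<open>W 3 1\<close> and
  \<open>W 1 2\<close>.\<close>

definition W :: "3 \<Rightarrow> 3 \<Rightarrow> real^3 \<Rightarrow> real" where "W j i x = pd j (U i) x - pd i (U j) x"
abbreviation Q where "Q \<equiv> head_pressure u p"

lemma smooth_U [smooth_intros]: "smooth (U i)"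
  unfolding U_def[abs_def] by (rule smooth_component[OF smooth_u])

lemma pd_U: "pd i (U j) x = pd i u x $ j"
  using pd_component[OF smooth_u, of i j] by (simp add: U_def[abs_def])

lemma laplacian_U: "laplacian (U j) x = laplacian u x $ j"
  using laplacian_component[OF smooth_u, of j] by (simp add: U_def[abs_def])

lemma div_U: "(\<Sum>i\<in>UNIV. pd i (U i) x) = 0"
  using equation by (simp add: stationary_Navier_Stokes_def divergence_def pd_U)

lemma pd_p: "pd j p = (\<lambda>x. laplacian (U j) x - (\<Sum>i\<in>UNIV. U i x * pd i (U j) x))"
proof
  fix x
  have "- laplacian u x + convective u u x + grad p x = 0"
    using equation by (simp add: stationary_Navier_Stokes_def)
  then have "(- laplacian u x + convective u u x + grad p x) $ j = 0" by simp
  then show "pd j p x = laplacian (U j) x - (\<Sum>i\<in>UNIV. U i x * pd i (U j) x)"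
    by (simp add: laplacian_U convective_def grad_def pd_U U_def)
qed

lemma Q_eq: "Q = (\<lambda>x. 1/2 * (\<Sum>i\<in>UNIV. U i x * U i x) + p x)"
  by (simp add: fun_eq_iff head_pressure_def norm_vec_def L2_set_def sum_nonneg U_def power2_eq_square)

lemma smooth_Q [smooth_intros]: "smooth Q"
  unfolding Q_eq by (intro smooth_intros smooth_p)

text \<open>The gradient of the kinetic energy and the convective term in \<open>pd_p\<close>
  combine into the antisymmetrised derivative contracted with \<open>u\<close>, which is the Lamb
  vector \<open>u x curl u\<close>.\<close>

lemma pd_Q: "pd j Q = (\<lambda>x. (\<Sum>i\<in>UNIV. U i x * W j i x) + laplacian (U j) x)"
proof -
  have "pd j Q = (\<lambda>x. pd j (\<lambda>x. 1/2 * (\<Sum>i\<in>UNIV. U i x * U i x)) x + pd j p x)"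
    unfolding Q_eq by (intro pd_add smooth_intros smooth_p)
  also have "pd j (\<lambda>x. 1/2 * (\<Sum>i\<in>UNIV. U i x * U i x)) = (\<lambda>x. \<Sum>i\<in>UNIV. U i x * pd j (U i) x)"
    by (subst pd_mult) (simp_all add: pd_sum pd_mult smooth_intros mult.commute flip: sum_distrib_left)
  finally show ?thesis
    by (simp add: pd_p W_def fun_eq_iff right_diff_distrib sum_subtractf)
qed

lemma smooth_W [smooth_intros]: "smooth (W j i)"
  unfolding W_def[abs_def] by (intro smooth_intros)

text \<open>Divergence and Laplacian commute.\<close>

lemma div_laplacian_U: "(\<Sum>j\<in>UNIV. pd j (laplacian (U j)) x) = 0"
proof -
  have "(\<Sum>j\<in>UNIV. pd j (laplacian (U j)) x) = (\<Sum>j\<in>UNIV. \<Sum>i\<in>UNIV. pd i (pd i (pd j (U j))) x)"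
    unfolding laplacian_def[abs_def]
    by (simp add: pd_sum smooth_intros pd_commute)
  also have "\<dots> = (\<Sum>i\<in>UNIV. \<Sum>j\<in>UNIV. pd i (pd i (pd j (U j))) x)"
    by (rule sum.swap)
  also have "\<dots> = (\<Sum>i\<in>UNIV. pd i (pd i (\<lambda>x. \<Sum>j\<in>UNIV. pd j (U j) x)) x)"
    by (simp add: pd_sum smooth_intros)
  also have "\<dots> = 0" by (simp add: div_U)
  finally show ?thesis .
qed

text \<open>This is \<open>laplacian u = - curl (curl u)\<close> for a divergence-free field: the
  other half of \<open>W\<close> contributes a derivative of the divergence.\<close>

lemma div_W: "(\<Sum>j\<in>UNIV. pd j (W j i) x) = laplacian (U i) x"
proof -
  have "(\<Sum>j\<in>UNIV. pd j (W j i) x) = laplacian (U i) x - (\<Sum>j\<in>UNIV. pd j (pd i (U j)) x)"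
    unfolding W_def[abs_def] laplacian_def by (simp add: pd_diff smooth_intros sum_subtractf)
  also have "(\<Sum>j\<in>UNIV. pd j (pd i (U j)) x) = (\<Sum>j\<in>UNIV. pd i (pd j (U j)) x)"
    by (intro sum.cong refl) (simp add: pd_commute[OF smooth_U, of _ i])
  also have "\<dots> = pd i (\<lambda>x. \<Sum>j\<in>UNIV. pd j (U j) x) x"
    by (simp add: pd_sum smooth_intros)
  also have "\<dots> = 0" by (simp add: div_U)
  finally show ?thesis by simp
qed

text \<open>By antisymmetry of \<open>W\<close> the double sum is half the sum of all squared
  entries, in which each vorticity component occurs twice.\<close>

lemma norm_curl_sq: "(norm (curl u x))\<^sup>2 = (\<Sum>j\<in>UNIV. \<Sum>i\<in>UNIV. pd j (U i) x * W j i x)"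
  unfolding power2_norm_eq_inner
  by (simp add: inner_vec_def sum_3 curl_def vector_3 W_def pd_U
    algebra_simps)

text \<open>Take the divergence of \<open>pd_Q\<close>. The viscous term disappears, derivatives of
  \<open>u\<close> produce the enstrophy, and derivatives of \<open>W\<close> produce
  \<open>u . laplacian u\<close>.\<close>

lemma laplacian_Q: "laplacian Q x - (\<Sum>i\<in>UNIV. U i x * pd i Q x) = (norm (curl u x))\<^sup>2"
proof -
  have "laplacian Q x = (\<Sum>j\<in>UNIV. (\<Sum>i\<in>UNIV. U i x * pd j (W j i) x + pd j (U i) x * W j i x)
      + pd j (laplacian (U j)) x)"
    unfolding laplacian_def[of Q] by (simp add: pd_Q pd_add pd_sum pd_mult smooth_intros)
  also have "\<dots> = (\<Sum>j\<in>UNIV. \<Sum>i\<in>UNIV. U i x * pd j (W j i) x) + (norm (curl u x))\<^sup>2"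
    by (simp add: sum.distrib div_laplacian_U norm_curl_sq)
  also have "(\<Sum>j\<in>UNIV. \<Sum>i\<in>UNIV. U i x * pd j (W j i) x) = (\<Sum>i\<in>UNIV. U i x * laplacian (U i) x)"
    by (subst sum.swap) (simp add: div_W flip: sum_distrib_left)
  \<comment> \<open>The Lamb vector is orthogonal to \<open>u\<close>, so \<open>u . grad Q\<close>
    reduces to \<open>u . laplacian u\<close>.\<close>
  also have "\<dots> = (\<Sum>i\<in>UNIV. U i x * pd i Q x)"
    by (simp add: pd_Q sum_3 W_def algebra_simps)
  finally show ?thesis by simp
qed

lemma grad_Q: "grad Q x = cross3 (u x) (curl u x) + laplacian u x"
  by (simp add: vec_eq_iff forall_3 grad_def pd_Q sum_3 cross3_def curl_def vector_3 W_def pd_U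
    laplacian_U U_def algebra_simps)

text \<open>Only the component of the Lamb vector along \<open>grad Q\<close> enters, and it is
  determined by the tangential parts of velocity and vorticity. At critical points of
  \<open>Q\<close> both sides are 0.\<close>

lemma abs_grad_inner_Lamb:
  "\<bar>grad Q x \<bullet> cross3 (u x) (curl u x)\<bar> \<le>
    norm (grad Q x) * (norm (u_tan u p x) * \<bar>Theta u p x\<bar> * norm (omega_tan u p x))"
proof (cases "norm (grad Q x) > 0")
  case True
  define n where "n = normal_Q u p x"
  have n: "grad Q x = norm (grad Q x) *\<^sub>R n" "norm n = 1"
    using True by (auto simp: n_def normal_Q_def)
  let ?c = "cross3 (u_tan u p x) (omega_tan u p x)"
  have "?c \<bullet> n = cross3 (u x) (curl u x) \<bullet> n"
    using True cross3_tangential[OF n(2), of "u x" "curl u x"]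
    by (simp add: u_tan_def omega_tan_def tangential_def n_def)
  moreover have "grad Q x \<bullet> cross3 (u x) (curl u x) = norm (grad Q x) * (cross3 (u x) (curl u x) \<bullet> n)"
    by (subst n(1)) (simp add: inner_commute)
  moreover have "\<bar>?c \<bullet> n\<bar> = norm (u_tan u p x) * \<bar>Theta u p x\<bar> * norm (omega_tan u p x)"
  proof (cases "norm (u_tan u p x) * norm (omega_tan u p x) = 0")
    case True
    then show ?thesis by auto
  next
    case False
    then show ?thesis using True
      by (simp add: Theta_def n_def abs_mult less_le)
  qed
  ultimately show ?thesis by (simp add: abs_mult)
qed simp

text \<open>The left side equals the \<open>h\<close>-weighted integral of the squared gradient of
  \<open>Q\<close>, which also equals that of \<open>grad Q\<close> against the Lamb vector. Young's
  inequality splits the latter so that half of the former can be absorbed.\<close>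

lemma enstrophy_bound:
  assumes lim: "(Q \<longlongrightarrow> 0) at_infinity"
    and e: "0 < e" and zero: "\<And>t. t \<le> e \<Longrightarrow> h t = 0" and h: "continuous_on UNIV h"
    and nonneg: "\<And>t. 0 \<le> h t"
    and H: "integrable lebesgue H"
    and bound: "\<And>x. h (- Q x) * (norm (u_tan u p x) * \<bar>Theta u p x\<bar> * norm (omega_tan u p x))\<^sup>2 \<le> H x"
  shows "(\<integral>x. integral {0..- Q x} h * (norm (curl u x))\<^sup>2 \<partial>lborel) \<le> integral\<^sup>L lebesgue H"
proof -
  define f where "f x = - Q x" for x
  define \<psi> where "\<psi> t = integral {0..t} h" for t
  have \<psi>: "(\<psi> has_real_derivative h t) (at t)" for t
    unfolding \<psi>_def using e by (intro has_real_derivative_integral_from_0 h zero) auto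
  have zero\<psi>: "\<psi> t = 0" if "t \<le> e" for t
    unfolding \<psi>_def using zero that by (rule integral_from_0_eq_0)
  have c\<psi>: "continuous_on UNIV \<psi>"
    using \<psi> by (auto simp: continuous_on_eq_continuous_at intro: DERIV_isCont)
  have f: "smooth f" and limf: "(f \<longlongrightarrow> 0) at_infinity"
    using tendsto_minus[OF lim] by (simp_all add: f_def[abs_def] smooth_intros)
  have pdf: "pd i f x = - pd i Q x" for i x
    by (simp add: f_def[abs_def] pd_minus smooth_Q)
  have lapf: "laplacian f x = - laplacian Q x" for x
    unfolding laplacian_def f_def[abs_def] by (simp add: pd_minus smooth_intros sum_negf)
  have gradQ: "(\<Sum>i\<in>UNIV. (pd i f x)\<^sup>2) = (norm (grad Q x))\<^sup>2" for x
    unfolding power2_norm_eq_inner by (simp add: inner_vec_def grad_def pdf power2_eq_square)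
  let ?N = "\<lambda>x. (norm (grad Q x))\<^sup>2" and ?O = "\<lambda>x. (norm (curl u x))\<^sup>2"
    and ?P = "\<lambda>x. grad Q x \<bullet> cross3 (u x) (curl u x)"
  have cN: "continuous_on UNIV ?N"
    unfolding gradQ[symmetric] by (intro continuous_intros smooth_imp_continuous_on smooth_pd f)
  have cO: "continuous_on UNIV ?O"
    unfolding norm_curl_sq by (intro continuous_intros smooth_imp_continuous_on smooth_intros)
  \<comment> \<open>The viscous part of \<open>grad Q\<close> enters with a plus sign because
    \<open>f = -Q\<close>.\<close>
  have P: "?P x = ?N x + (\<Sum>i\<in>UNIV. pd i f x * laplacian (U i) x)" for x
  proof -
    have "?N x = ?P x + grad Q x \<bullet> laplacian u x"
      unfolding power2_norm_eq_inner by (subst (2) grad_Q) (simp add: inner_add_right)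
    then show ?thesis
      by (simp add: inner_vec_def grad_def pdf laplacian_U sum_negf)
  qed
  have cP: "continuous_on UNIV ?P"
    unfolding P by (intro continuous_intros cN smooth_imp_continuous_on smooth_intros f)
  have intN: "integrable lborel (\<lambda>x. h (f x) * ?N x)" and intP: "integrable lborel (\<lambda>x. h (f x) * ?P x)"
    by (intro integrable_level[OF _ _ limf e zero h] smooth_imp_continuous_on f cN cP; assumption)+
  have intO: "integrable lborel (\<lambda>x. \<psi> (f x) * ?O x)"
    by (intro integrable_level[OF _ _ limf e zero\<psi> c\<psi>] smooth_imp_continuous_on f cO; assumption)
  have "(\<lambda>x. h (f x) * (\<Sum>i\<in>UNIV. (pd i f x)\<^sup>2) +
      integral {0..f x} h * (laplacian f x - (\<Sum>i\<in>UNIV. U i x * pd i f x))) =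
    (\<lambda>x. h (f x) * ?N x - \<psi> (f x) * ?O x)"
    unfolding gradQ \<psi>_def[symmetric] laplacian_Q[symmetric]
    by (simp add: pdf lapf sum_negf fun_eq_iff algebra_simps)
  with energy_identity[OF f smooth_U limf div_U e zero h]
  have "has_bochner_integral lborel (\<lambda>x. h (f x) * ?N x - \<psi> (f x) * ?O x) 0" by simp
  then have ON: "(\<integral>x. \<psi> (f x) * ?O x \<partial>lborel) = (\<integral>x. h (f x) * ?N x \<partial>lborel)"
    using intN intO by (simp add: has_bochner_integral_iff)
  \<comment> \<open>The divergence-free field \<open>laplacian u\<close> is tested with
    \<open>\<psi> (f)\<close>, which removes it from the gradient integral.\<close>
  have "has_bochner_integral lborel
      (\<lambda>x. \<Sum>i\<in>UNIV. h (f x) * (pd i f x * laplacian (U i) x) + \<psi> (f x) * pd i (laplacian (U i)) x)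
      (\<Sum>i\<in>(UNIV::3 set). 0)"
    by (intro has_bochner_integral_sum integral_by_parts_level[OF f _ limf e zero\<psi> zero \<psi> h]
      smooth_intros)
  also have "(\<lambda>x. \<Sum>i\<in>UNIV. h (f x) * (pd i f x * laplacian (U i) x) + \<psi> (f x) * pd i (laplacian (U i)) x)
      = (\<lambda>x. h (f x) * ?P x - h (f x) * ?N x)"
    by (simp add: P sum.distrib div_laplacian_U distrib_left flip: sum_distrib_left)
  finally have NP: "(\<integral>x. h (f x) * ?N x \<partial>lborel) = (\<integral>x. h (f x) * ?P x \<partial>lborel)"
    using intN intP by (simp add: has_bochner_integral_iff)
  have young: "h (f x) * ?P x \<le> 1/2 * (h (f x) * ?N x) + 1/2 * H x" for x
  proof -
    define T where "T = norm (u_tan u p x) * \<bar>Theta u p x\<bar> * norm (omega_tan u p x)"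
    have "?P x \<le> norm (grad Q x) * T"
      using abs_grad_inner_Lamb[of x] by (simp add: T_def)
    also have "\<dots> \<le> 1/2 * ?N x + 1/2 * T\<^sup>2"
      using sum_squares_bound[of "norm (grad Q x)" T] by simp
    finally have "h (f x) * ?P x \<le> h (f x) * (1/2 * ?N x + 1/2 * T\<^sup>2)"
      using nonneg by (rule mult_left_mono)
    then show ?thesis using bound[of x] by (simp add: T_def f_def distrib_left)
  qed
  \<comment> \<open>\<open>H\<close> is integrable for Lebesgue measure only, so the comparison is
    made on the completion.\<close>
  have "(\<integral>x. h (f x) * ?P x \<partial>lborel) = (\<integral>x. h (f x) * ?P x \<partial>lebesgue)"
    using intP by (simp add: integral_completion)
  also have "\<dots> \<le> (\<integral>x. 1/2 * (h (f x) * ?N x) + 1/2 * H x \<partial>lebesgue)"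
    using intP intN H young
    by (intro integral_mono Bochner_Integration.integrable_add integrable_mult_right)
      (auto simp: integrable_completion)
  also have "\<dots> = 1/2 * (\<integral>x. h (f x) * ?N x \<partial>lebesgue) + 1/2 * integral\<^sup>L lebesgue H"
    using intN H by (subst Bochner_Integration.integral_add) (auto simp: integrable_completion)
  also have "(\<integral>x. h (f x) * ?N x \<partial>lebesgue) = (\<integral>x. h (f x) * ?N x \<partial>lborel)"
    using intN by (simp add: integral_completion)
  \<comment> \<open>With \<open>X\<close> the common value of the integrals in \<open>ON\<close> and
    \<open>NP\<close>, the chain reads \<open>X <= X/2 + (integral of H)/2\<close>, so
    \<open>X\<close> is at most the integral of \<open>H\<close>.\<close>
  finally show ?thesis using ON NP by (simp add: f_def \<psi>_def)
qed

text \<open>The weighted enstrophy is bounded independently of the truncation of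
  \<open>1 / \<xi>\<close>, whereas the weight exceeds any \<open>M\<close> on a fixed superlevel
  set of \<open>-Q\<close> around \<open>y\<close>.\<close>

lemma curl_eq_0:
  fixes \<xi> :: "real \<Rightarrow> real" and q r :: ennreal and a b :: real
  assumes lim: "(Q \<longlongrightarrow> 0) at_infinity"
    and cont: "continuous_on {0..} \<xi>" and mono: "mono_on {0..} \<xi>"
    and pos: "\<And>s. s > 0 \<Longrightarrow> \<xi> s > 0"
    and div: "(\<integral>\<^sup>+s\<in>{0<..<1}. ennreal (1 / \<xi> s) \<partial>lebesgue) = \<infinity>"
    and qr: "2 \<le> q" "2 \<le> r" "1 / q + 1 / r = 1 / 2" and ab: "a + b = 1 / 2"
    and A: "in_Lp lebesgue q (\<lambda>x. norm (u_tan u p x) * \<bar>Theta u p x\<bar> / \<xi> \<bar>Q x\<bar> powr a)"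
    and B: "in_Lp lebesgue r (\<lambda>x. norm (omega_tan u p x) / \<xi> \<bar>Q x\<bar> powr b)"
    and y: "Q y < 0"
  shows "curl u y = 0"
proof -
  define H where "H x = (norm (u_tan u p x) * \<bar>Theta u p x\<bar> / \<xi> \<bar>Q x\<bar> powr a *
    (norm (omega_tan u p x) / \<xi> \<bar>Q x\<bar> powr b))\<^sup>2" for x
  have H: "integrable lebesgue H"
    unfolding H_def by (rule in_Lp_mult_square_integrable[OF A B qr])
  \<comment> \<open>Half the value of \<open>-Q\<close> at \<open>y\<close>, so that
    \<open>y\<close> lies strictly inside the region where \<open>-Q\<close> exceeds
    \<open>s\<close>.\<close>
  define s where "s = - Q y / 2"
  have s: "0 < s" "s < - Q y" using y by (simp_all add: s_def)
  \<comment> \<open>A fixed cutoff, positive exactly above \<open>s\<close>; \<open>K\<close> is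
    then an enstrophy that does not depend on the truncation parameters.\<close>
  define k :: "real \<Rightarrow> real" where "k t = min 1 (max 0 (t - s))" for t
  have k: "continuous_on UNIV k" unfolding k_def by (intro continuous_intros)
  have k0: "k t = 0" if "t \<le> s" for t using that by (simp add: k_def)
  have limf: "((\<lambda>x. - Q x) \<longlongrightarrow> 0) at_infinity" using tendsto_minus[OF lim] by simp
  have cf: "continuous_on UNIV (\<lambda>x. - Q x)"
    by (intro continuous_intros smooth_imp_continuous_on smooth_Q)
  let ?O = "\<lambda>x. (norm (curl u x))\<^sup>2"
  have cO: "continuous_on UNIV ?O"
    unfolding norm_curl_sq by (intro continuous_intros smooth_imp_continuous_on smooth_intros)
  define K where "K = (\<integral>x. k (- Q x) * ?O x \<partial>lborel)"
  have intK: "integrable lborel (\<lambda>x. k (- Q x) * ?O x)"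
    by (rule integrable_level[OF cf cO limf s(1) k0 k])
  have main: "M * K \<le> integral\<^sup>L lebesgue H" if M: "0 \<le> M" for M
  proof -
    have "\<exists>e>0. e < s \<and> M < integral {e..s} (\<lambda>t. 1 / \<xi> t)"
    proof (rule ccontr)
      assume "\<not> ?thesis"
      then have "integral {e..s} (\<lambda>t. 1 / \<xi> t) \<le> M" if "0 < e" "e < s" for e
        using that by (meson not_less)
      from nn_integral_inverse_le[OF cont mono pos s(1) this] div show False
        by (simp add: top_unique flip: ennreal_plus)
    qed
    then obtain d where d: "0 < d" "d < s" "M < integral {d..s} (\<lambda>t. 1 / \<xi> t)" by blast
    define e where "e = d / 2"
    have e: "0 < e" using d by (simp add: e_def)
    define h where "h t = min 1 (max 0 ((t - e) / e)) / \<xi> (max e t)" for t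
    have \<xi>pos: "0 < \<xi> (max e t)" for t using e by (intro pos) auto
    have zero: "h t = 0" if "t \<le> e" for t
      using that e by (simp add: h_def max_absorb1 divide_nonpos_pos)
    have h: "continuous_on UNIV h"
      unfolding h_def
    proof (intro continuous_intros continuous_on_compose2[OF cont] ballI)
      show "\<xi> (max e t) \<noteq> 0" for t using \<xi>pos[of t] by simp
    qed (use e in auto)
    have nonneg: "0 \<le> h t" for t
      using \<xi>pos[of t] by (simp add: h_def)
    have h_int: "h integrable_on {x..y}" for x y
      using h by (intro integrable_continuous_interval) (auto intro: continuous_on_subset)
    have large: "M \<le> integral {0..t} h" if "s < t" for t
    proof -
      have "integral {d..s} (\<lambda>t. 1 / \<xi> t) = integral {d..s} h"
        using e by (intro integral_cong) (auto simp: h_def e_def field_simps max_def min_def)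
      also have "\<dots> \<le> integral {0..t} h"
        using d that nonneg by (intro integral_subset_le h_int) auto
      finally show ?thesis using d by simp
    qed
    have bound: "h (- Q x) * (norm (u_tan u p x) * \<bar>Theta u p x\<bar> * norm (omega_tan u p x))\<^sup>2 \<le> H x" for x
    \<comment> \<open>Where \<open>-Q\<close> is at most \<open>e\<close> the weight is 0, and only
      the sign of the square \<open>H x\<close> matters. Elsewhere \<open>a + b = 1/2\<close> makes
      the two denominators multiply to \<open>sqrt (\<xi> t)\<close>.\<close>
    proof (cases "- Q x \<le> e")
      case True
      then show ?thesis by (simp add: zero H_def)
    next
      case False
      define t where "t = - Q x"
      have t: "e < t" "\<bar>Q x\<bar> = t" using False e by (auto simp: t_def)
      have \<xi>t: "0 < \<xi> t" using t e by (intro pos) auto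
      have "\<xi> t powr a * \<xi> t powr b = sqrt (\<xi> t)"
        using \<xi>t by (simp only: powr_add[symmetric] ab powr_half_sqrt less_imp_le)
      then have "H x = ((norm (u_tan u p x) * \<bar>Theta u p x\<bar> * norm (omega_tan u p x)) / sqrt (\<xi> t))\<^sup>2"
        by (simp add: H_def t mult_ac)
      also have "\<dots> = 1 / \<xi> t * (norm (u_tan u p x) * \<bar>Theta u p x\<bar> * norm (omega_tan u p x))\<^sup>2"
        using \<xi>t by (simp add: power_divide)
      finally have "H x = 1 / \<xi> t * (norm (u_tan u p x) * \<bar>Theta u p x\<bar> * norm (omega_tan u p x))\<^sup>2" .
      moreover have "h t \<le> 1 / \<xi> t"
        using t \<xi>t by (simp add: h_def max_absorb2 divide_right_mono)
      ultimately show ?thesis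
        by (simp only: t_def[symmetric]) (intro mult_right_mono, auto)
    qed
    have 1: "(\<integral>x. integral {0..- Q x} h * ?O x \<partial>lborel) \<le> integral\<^sup>L lebesgue H"
      by (rule enstrophy_bound[OF lim e zero h nonneg H bound])
    have "((\<lambda>t. integral {0..t} h) has_real_derivative h t) (at t)" for t
      using e by (intro has_real_derivative_integral_from_0 h zero) auto
    then have c\<psi>: "continuous_on UNIV (\<lambda>t. integral {0..t} h)"
      by (auto simp: continuous_on_eq_continuous_at intro: DERIV_isCont)
    have int\<psi>: "integrable lborel (\<lambda>x. integral {0..- Q x} h * ?O x)"
      by (rule integrable_level[OF cf cO limf e integral_from_0_eq_0[OF zero] c\<psi>])
    have "M * K = (\<integral>x. M * (k (- Q x) * ?O x) \<partial>lborel)" by (simp add: K_def)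
    also have "\<dots> \<le> (\<integral>x. integral {0..- Q x} h * ?O x \<partial>lborel)"
    proof (intro integral_mono int\<psi> integrable_mult_right intK)
      fix x
      have "M * k t \<le> integral {0..t} h" for t
      proof (cases "s < t")
        case True
        have "M * k t \<le> M * 1" using M by (intro mult_left_mono) (auto simp: k_def)
        with large[OF True] show ?thesis by simp
      qed (use integral_nonneg[OF h_int nonneg] in \<open>auto simp: k0\<close>)
      then show "M * (k (- Q x) * ?O x) \<le> integral {0..- Q x} h * ?O x"
        by (simp add: mult_right_mono flip: mult.assoc)
    qed
    finally show ?thesis using 1 by simp
  qed
  have "K \<le> 0"
  proof (rule ccontr)
    assume K: "\<not> K \<le> 0"
    \<comment> \<open>This \<open>M\<close> makes \<open>M * K\<close> exceed the integral of
      \<open>H\<close> by at least 1.\<close>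
    then show False using main[of "(\<bar>integral\<^sup>L lebesgue H\<bar> + 1) / K"] by simp
  qed
  then have "k (- Q y) * ?O y = 0"
    unfolding K_def
    by (intro nonneg_integral_eq_0_continuous[where F = "\<lambda>x. k (- Q x) * ?O x"] intK
      continuous_intros cO continuous_on_compose2[OF k cf]) (auto simp: k_def)
  moreover have "k (- Q y) \<noteq> 0" using s by (simp add: k_def)
  ultimately show ?thesis by simp
qed

end

section \<open>Vanishing of the head pressure, then of the velocity\<close>

theorem theorem1p2:
  fixes u :: "real^3 \<Rightarrow> real^3" and p :: "real^3 \<Rightarrow> real"
    and \<xi> :: "real \<Rightarrow> real" and q r :: ennreal and a b :: real
  assumes "smooth u" and "smooth p"
    and "stationary_Navier_Stokes u p"
    and "(u \<longlongrightarrow> 0) at_infinity"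
    and "integrable lebesgue (grad_norm_sq u)"
    and "(head_pressure u p \<longlongrightarrow> 0) at_infinity"
    and "continuous_on {0..} \<xi>" and "mono_on {0..} \<xi>"
    and "\<xi> 0 = 0" and "\<And>s. s > 0 \<Longrightarrow> \<xi> s > 0"
    and "(\<integral>\<^sup>+s\<in>{0<..<1}. ennreal (1 / \<xi> s) \<partial>lebesgue) = \<infinity>"
    and "2 \<le> q" and "2 \<le> r" and "1 / q + 1 / r = 1 / 2"
    and "a + b = 1 / 2"
    and "in_Lp lebesgue q
           (\<lambda>x. norm (u_tan u p x) * \<bar>Theta u p x\<bar> / \<xi> \<bar>head_pressure u p x\<bar> powr a)"
    and "in_Lp lebesgue r
           (\<lambda>x. norm (omega_tan u p x) / \<xi> \<bar>head_pressure u p x\<bar> powr b)"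
  shows "\<forall>x. u x = 0"
proof
  interpret Navier_Stokes_solution u p
    by unfold_locales (fact assms)+
  note limQ = assms(6)
  have curl: "curl u x = 0" if "Q x < 0" for x
    by (rule curl_eq_0[OF limQ assms(7,8,10-17) that])
  have Q_le: "Q x \<le> 0" for x
  proof (rule decaying_subsolution_nonpos[OF smooth_Q smooth_U limQ div_U])
    show "(\<Sum>i\<in>UNIV. U i x * pd i Q x) \<le> laplacian Q x" for x
      using laplacian_Q[of x] by (smt (verit) zero_le_power2)
  qed
  \<comment> \<open>Where \<open>-Q\<close> is positive the vorticity vanishes, so
    \<open>laplacian_Q\<close> has zero right-hand side there and \<open>-Q\<close> is a subsolution
    on that set.\<close>
  have "- Q x \<le> 0" for x
  proof (rule decaying_subsolution_nonpos[OF smooth_minus[OF smooth_Q] smooth_U _ div_U])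
    show "((\<lambda>x. - Q x) \<longlongrightarrow> 0) at_infinity" using tendsto_minus[OF limQ] by simp
    show "(\<Sum>i\<in>UNIV. U i x * pd i (\<lambda>x. - Q x) x) \<le> laplacian (\<lambda>x. - Q x) x" if "0 < - Q x" for x
      using laplacian_Q[of x] curl[of x] that
      by (simp add: laplacian_def pd_minus smooth_intros sum_negf)
  qed
  then have "Q x = 0" for x using Q_le[of x] by (simp add: order_antisym)
  then have "Q = (\<lambda>x. 0)" by (rule ext)
  then have Q0: "grad Q x = 0" "laplacian Q x - (\<Sum>i\<in>UNIV. U i x * pd i Q x) = 0" for x
    by (simp_all add: grad_def laplacian_def vec_eq_iff)
  have "curl u x = 0" for x using laplacian_Q[of x] Q0(2)[of x] by simp
  then have lap: "laplacian (U i) x = 0" for i x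
    using grad_Q[of x] Q0(1)[of x] by (simp add: laplacian_U)
  have limU: "(U i \<longlongrightarrow> 0) at_infinity" for i
    using tendsto_vec_nth[OF assms(4), of i] by (simp add: U_def[abs_def])
  fix x
  \<comment> \<open>Each velocity component is harmonic and decays; the maximum principle with zero
    drift applies to it and to its negative.\<close>
  have "U i x \<le> 0" for i
    by (rule decaying_subsolution_nonpos[of "U i" "\<lambda>_ _. 0"])
      (auto simp: lap intro: limU smooth_intros)
  moreover have "- U i x \<le> 0" for i
  proof (rule decaying_subsolution_nonpos[of "\<lambda>x. - U i x" "\<lambda>_ _. 0"])
    show "((\<lambda>x. - U i x) \<longlongrightarrow> 0) at_infinity" using tendsto_minus[OF limU] by simp
    show "(\<Sum>j\<in>UNIV. 0 * pd j (\<lambda>x. - U i x) x) \<le> laplacian (\<lambda>x. - U i x) x" for x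
      using lap[of i x] by (simp add: laplacian_def pd_minus smooth_intros sum_negf)
  qed (auto intro: smooth_intros)
  ultimately have "U i x = 0" for i by (meson antisym neg_le_0_iff_le)
  then show "u x = 0" by (simp add: vec_eq_iff U_def)
qed

end
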